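(* Let $\mathcal{A}$ be the central arrangement of eight planes in $\mathbb{R}^3$ (coordinates $x,y,z$) defined by $$Q_{\mathcal{A}}=xyz(x+y)(x+2y)(x+z)(y-2z)(2y-z),$$ and let $\mathcal{A}^\kappa$ be the central arrangement of eight planes in $\mathbb{R}^3$ (coordinates $X,Y,Z$) defined by $$Q_{\mathcal{A}^\kappa}=XYZ(X+Y)(2X+Y)(X+Z)(Z-2Y)(2Z-Y).$$ Then $\mathrm{VG}(\mathcal{A})_R\cong\mathrm{VG}(\mathcal{A}^\kappa)_R$ as filtered $R$-algebras for every commutative ring $R$. However, the tope graph $\mathcal{T}(\mathcal{A})$ has a pair of antipodal vertices (chambers $C$ and $-C$) of degree $5$, while $\mathcal{T}(\mathcal{A}^\kappa)$ has no vertex of degree $5$; hence $\mathcal{T}(\mathcal{A})\not\cong\mathcal{T}(\mathcal{A}^\kappa)$ as graphs. Consequently the following assertion is false: for all real central hyperplane arrangements $\mathcal{B}_1,\mathcal{B}_2$ and every integral domain $R$ with $\operatorname{char}R\neq 2$, if $\mathrm{VG}(\mathcal{B}_1)_R\cong\mathrm{VG}(\mathcal{B}_2)_R$ as filtered $R$-algebras, then $\mathcal{T}(\mathcal{B}_1)\cong\mathcal{T}(\mathcal{B}_2)$.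
   Context: A central hyperplane arrangement $\mathcal{A}=\{H_1,\ldots,H_n\}$ in a real vector space $V$ is a finite set of linear hyperplanes. Each $H_i$ is the kernel of a chosen nonzero linear form $\alpha_i$ (a defining form); the arrangement defined by a product of pairwise non-proportional linear forms consists of the kernels of these forms. The complement is $M(\mathcal{A})=V\setminus\bigcup_iH_i$; its connected components are called chambers, and $\mathrm{Ch}(\mathcal{A})$ denotes the set of chambers. The tope graph $\mathcal{T}(\mathcal{A})$ is the simple graph with vertex set $\mathrm{Ch}(\mathcal{A})$, two chambers being adjacent when they are separated by exactly one hyperplane of $\mathcal{A}$. For a commutative ring $R$, the Varchenko--Gelfand algebra is $\mathrm{VG}(\mathcal{A})_R=R^{\mathrm{Ch}(\mathcal{A})}$, the $R$-algebra of all functions $\mathrm{Ch}(\mathcal{A})\to R$ with pointwise operations. For a defining form $\alpha_i$, the Heaviside function $h_{\alpha_i}\in\mathrm{VG}(\mathcal{A})_R$ takes the value $1$ on a chamber $C$ if $\alpha_i>0$ on $C$, and $0$ if $\alpha_i<0$ on $C$. For $p\ge 0$, $F^p\mathrm{VG}(\mathcal{A})_R$ is the $R$-linear span of all products of at most $p$ Heaviside functions (the empty product being $1$); it does not depend on the choice of defining forms, since $h_{-\alpha_i}=1-h_{\alpha_i}$. An isomorphism of filtered $R$-algebras is an $R$-algebra isomorphism carrying the $p$-th filtered piece onto the $p$-th filtered piece for every $p\ge 0$. *)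

theory Defs
  imports "HOL-Analysis.Analysis" "HOL-Analysis.Finite_Function_Topology" "HOL-Algebra.QuotRing" "HOL-Algebra.Module"
begin

section \<open>Central arrangements, chambers, tope graphs\<close>

text \<open>
  The ambient finite-dimensional real vector space is a linear subspace \<open>V\<close> of some normed space
  type, so that one type can host ambient spaces of every finite dimension; \<open>V = UNIV\<close> for
  arrangements in \<open>real ^ 'n\<close>.  On a finite-dimensional \<open>V\<close> the subspace topology is the usual one,
  and every linear form on \<open>V\<close> is the restriction of a linear form on the whole type.
\<close>

definition linear_hyperplane :: "'v::real_vector set \<Rightarrow> ('v \<Rightarrow> real) \<Rightarrow> 'v set" where
  "linear_hyperplane V \<alpha> = {v \<in> V. \<alpha> v = 0}"

definition defining_form :: "'v::real_vector set \<Rightarrow> 'v set \<Rightarrow> ('v \<Rightarrow> real) \<Rightarrow> bool" where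
  "defining_form V H \<alpha> \<longleftrightarrow> linear \<alpha> \<and> (\<exists>v\<in>V. \<alpha> v \<noteq> 0) \<and> H = linear_hyperplane V \<alpha>"

definition central_arrangement :: "'v::real_vector set \<Rightarrow> 'v set set \<Rightarrow> bool" where
  "central_arrangement V A \<longleftrightarrow>
     subspace V \<and> (\<exists>B. finite B \<and> V = span B) \<and>
     finite A \<and> (\<forall>H\<in>A. \<exists>\<alpha>. defining_form V H \<alpha>)"

definition complement :: "'v set \<Rightarrow> 'v set set \<Rightarrow> 'v set" where
  "complement V A = V - \<Union>A"

definition chambers :: "'v::real_normed_vector set \<Rightarrow> 'v set set \<Rightarrow> 'v set set" where
  "chambers V A = components (complement V A)"

definition antipode :: "'v::real_vector set \<Rightarrow> 'v set" where
  "antipode C = uminus ` C"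

definition separates :: "'v::real_vector set \<Rightarrow> 'v set \<Rightarrow> 'v set \<Rightarrow> 'v set \<Rightarrow> bool" where
  "separates V H C D \<longleftrightarrow>
     (\<exists>\<alpha>. defining_form V H \<alpha> \<and> (\<forall>x\<in>C. \<alpha> x > 0) \<and> (\<forall>x\<in>D. \<alpha> x < 0))"

record 'a graph =
  verts :: "'a set"
  edges :: "'a set set"

definition vertex_degree :: "'a graph \<Rightarrow> 'a \<Rightarrow> nat" where
  "vertex_degree G v = card {e \<in> edges G. v \<in> e}"

definition graph_isomorphic :: "'a graph \<Rightarrow> 'b graph \<Rightarrow> bool" where
  "graph_isomorphic G H \<longleftrightarrow>
     (\<exists>f. bij_betw f (verts G) (verts H) \<and>
          (\<forall>u\<in>verts G. \<forall>v\<in>verts G. {u, v} \<in> edges G \<longleftrightarrow> {f u, f v} \<in> edges H))"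

definition tope_graph :: "'v::real_normed_vector set \<Rightarrow> 'v set set \<Rightarrow> 'v set graph" where
  "tope_graph V A =
     \<lparr> verts = chambers V A,
       edges = {{C, D} | C D. C \<in> chambers V A \<and> D \<in> chambers V A \<and>
                              card {H \<in> A. separates V H C D} = 1} \<rparr>"

section \<open>The filtered Varchenko--Gelfand algebra\<close>

text \<open>Functions on the set of chambers are extensional, i.e. \<open>undefined\<close> off \<open>chambers V A\<close>.\<close>

definition VG ::
  "'v::real_normed_vector set \<Rightarrow> 'v set set \<Rightarrow> 'r ring \<Rightarrow> ('r, 'v set \<Rightarrow> 'r) module" where
  "VG V A R =
     \<lparr> carrier = chambers V A \<rightarrow>\<^sub>E carrier R,
       mult = (\<lambda>f g. \<lambda>C\<in>chambers V A. f C \<otimes>\<^bsub>R\<^esub> g C),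
       one = (\<lambda>C\<in>chambers V A. \<one>\<^bsub>R\<^esub>),
       zero = (\<lambda>C\<in>chambers V A. \<zero>\<^bsub>R\<^esub>),
       add = (\<lambda>f g. \<lambda>C\<in>chambers V A. f C \<oplus>\<^bsub>R\<^esub> g C),
       smult = (\<lambda>a f. \<lambda>C\<in>chambers V A. a \<otimes>\<^bsub>R\<^esub> f C) \<rparr>"

definition heaviside ::
  "'v::real_normed_vector set \<Rightarrow> 'v set set \<Rightarrow> 'r ring \<Rightarrow> ('v \<Rightarrow> real) \<Rightarrow> 'v set \<Rightarrow> 'r" where
  "heaviside V A R \<alpha> = (\<lambda>C\<in>chambers V A. if \<forall>x\<in>C. \<alpha> x > 0 then \<one>\<^bsub>R\<^esub> else \<zero>\<^bsub>R\<^esub>)"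

definition module_span :: "'r ring \<Rightarrow> ('r, 'm) module \<Rightarrow> 'm set \<Rightarrow> 'm set" where
  "module_span R M S =
     {(\<Oplus>\<^bsub>M\<^esub>s\<in>T. c s \<odot>\<^bsub>M\<^esub> s) | c T. finite T \<and> T \<subseteq> S \<and> c \<in> T \<rightarrow> carrier R}"

text \<open>
  All defining forms of each hyperplane are admitted, rather than one chosen form; the span is the
  same, because the Heaviside function of a form depends only on the form up to a positive factor
  and that of its negative is one minus it.
\<close>

definition VG_filtration ::
  "'v::real_normed_vector set \<Rightarrow> 'v set set \<Rightarrow> 'r ring \<Rightarrow> nat \<Rightarrow> ('v set \<Rightarrow> 'r) set" where
  "VG_filtration V A R p =
     module_span R (VG V A R)
       {foldr (mult (VG V A R)) hs \<one>\<^bsub>VG V A R\<^esub> | hs.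
          length hs \<le> p \<and>
          set hs \<subseteq> {heaviside V A R \<alpha> | \<alpha>. \<exists>H\<in>A. defining_form V H \<alpha>}}"

definition filtered_algebra_isomorphic ::
  "'r ring \<Rightarrow> ('r, 'm) module \<Rightarrow> (nat \<Rightarrow> 'm set) \<Rightarrow> ('r, 'n) module \<Rightarrow> (nat \<Rightarrow> 'n set) \<Rightarrow> bool" where
  "filtered_algebra_isomorphic R M F N G \<longleftrightarrow>
     (\<exists>\<phi>\<in>ring_iso M N.
        (\<forall>a\<in>carrier R. \<forall>f\<in>carrier M. \<phi> (a \<odot>\<^bsub>M\<^esub> f) = a \<odot>\<^bsub>N\<^esub> \<phi> f) \<and>
        (\<forall>p. \<phi> ` F p = G p))"

definition VG_isomorphic ::
  "'r ring \<Rightarrow> 'v::real_normed_vector set \<Rightarrow> 'v set set \<Rightarrow> 'w::real_normed_vector set \<Rightarrow> 'w set set \<Rightarrow> bool"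
  where
  "VG_isomorphic R V A W B \<longleftrightarrow>
     filtered_algebra_isomorphic R (VG V A R) (VG_filtration V A R) (VG W B R) (VG_filtration W B R)"

definition ring_char :: "'r ring \<Rightarrow> nat" where
  "ring_char R =
     (if \<exists>n::nat. n > 0 \<and> [n] \<cdot>\<^bsub>R\<^esub> \<one>\<^bsub>R\<^esub> = \<zero>\<^bsub>R\<^esub>
      then LEAST n::nat. n > 0 \<and> [n] \<cdot>\<^bsub>R\<^esub> \<one>\<^bsub>R\<^esub> = \<zero>\<^bsub>R\<^esub> else 0)"

section \<open>The two arrangements of eight planes\<close>

definition arrangement_A :: "(real ^ 3) set set" where
  "arrangement_A = linear_hyperplane UNIV `
     {\<lambda>v. v$1, \<lambda>v. v$2, \<lambda>v. v$3,
      \<lambda>v. v$1 + v$2, \<lambda>v. v$1 + 2 * v$2, \<lambda>v. v$1 + v$3,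
      \<lambda>v. v$2 - 2 * v$3, \<lambda>v. 2 * v$2 - v$3}"

definition arrangement_A_kappa :: "(real ^ 3) set set" where
  "arrangement_A_kappa = linear_hyperplane UNIV `
     {\<lambda>v. v$1, \<lambda>v. v$2, \<lambda>v. v$3,
      \<lambda>v. v$1 + v$2, \<lambda>v. 2 * v$1 + v$2, \<lambda>v. v$1 + v$3,
      \<lambda>v. v$3 - 2 * v$2, \<lambda>v. 2 * v$3 - v$2}"

end

theory Submission
  imports Defs "HOL-Algebra.IntRing"
begin

text \<open>
  The two arrangements are exchanged by the Cremona transformation
  \<open>(x, y, z) \<mapsto> (1/x, 1/y, 1/z)\<close>, which maps the complement of one homeomorphically onto that of the
  other: for instance \<open>1/x + 2/y = (2x + y)/(xy)\<close>.  Hence it induces a bijection of chambers, and so an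
  isomorphism of the algebras of functions.  The bijection keeps the signs of the three coordinates,
  and multiplies the sign of each further form, say one in \<open>x\<close> and \<open>y\<close>, by the signs of \<open>x\<close> and \<open>y\<close>.
  This product of three signs looks like a function of degree three, but the linear relation
  between the three forms makes it an affine function of the three Heaviside functions:
  for \<open>f = x + y\<close> the indicator of \<open>xyf > 0\<close> is \<open>h\<^sub>x + h\<^sub>y - h\<^sub>f\<close>
  (lemmas \<open>cremona_three_term_A\<close> and \<open>cremona_three_term_kappa\<close>).  Degree one is therefore preserved in both
  directions, and with it the filtration, which degree one generates; the coefficients are \<open>1\<close> and
  \<open>-1\<close>, so the argument works over every commutative ring.

  The transformation does not preserve adjacency, as it is not linear.  All questions are reduced to
  sign vectors: chambers are the nonempty cells on which all forms have constant sign, and the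
  degree of a chamber in the tope graph is the number of single signs that can be flipped within
  the set of realised sign vectors (\<open>degree_cell\<close>).  In the first arrangement the chamber of
  \<open>(-1, 2, 2)\<close> has five walls (\<open>pentagon_flips\<close>).  In the second one, five linear relations,
  between three forms each, together forbid at least four of the eight flips of every sign vector
  (\<open>kappa_flips\<close>), so all degrees are at most four.

  For the refutation of the general assertion the arrangements are pulled back along the
  coordinates of a three-dimensional space of finitely supported sequences, which does not change the
  sign vectors (\<open>topes_pullback\<close>), and the ring is that of the integers.
\<close>

section \<open>Filtrations generated by a set in an algebra\<close>

text \<open>
  The span that generates the filtration is only typed over unextended ring and module records, so
  the algebra locale is specialised to those record types.
\<close>

locale plain_algebra = algebra R M
  for R :: "'r ring" (structure) and M :: "('r, 'm) module" (structure)
begin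

lemma module_span_closed: "S \<subseteq> carrier M \<Longrightarrow> module_span R M S \<subseteq> carrier M"
  unfolding module_span_def by (force intro!: M.finsum_closed)

lemma module_span_minimal:
  assumes "S \<subseteq> N" "N \<subseteq> carrier M" "\<zero>\<^bsub>M\<^esub> \<in> N"
    and add: "\<And>x y. x \<in> N \<Longrightarrow> y \<in> N \<Longrightarrow> x \<oplus>\<^bsub>M\<^esub> y \<in> N"
    and smult: "\<And>a x. a \<in> carrier R \<Longrightarrow> x \<in> N \<Longrightarrow> a \<odot>\<^bsub>M\<^esub> x \<in> N"
  shows "module_span R M S \<subseteq> N"
proof
  have SM: "S \<subseteq> carrier M" using assms(1,2) by blast
  fix x assume "x \<in> module_span R M S"
  then obtain c T where T: "finite T" "T \<subseteq> S" "c \<in> T \<rightarrow> carrier R"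
    and x: "x = (\<Oplus>\<^bsub>M\<^esub>s\<in>T. c s \<odot>\<^bsub>M\<^esub> s)"
    unfolding module_span_def by blast
  from T have "(\<Oplus>\<^bsub>M\<^esub>s\<in>T. c s \<odot>\<^bsub>M\<^esub> s) \<in> N"
  proof (induction T rule: finite_induct)
    case (insert s T)
    then have "c s \<odot>\<^bsub>M\<^esub> s \<in> N" using assms(1) smult by auto
    moreover have "(\<Oplus>\<^bsub>M\<^esub>s\<in>insert s T. c s \<odot>\<^bsub>M\<^esub> s) =
        c s \<odot>\<^bsub>M\<^esub> s \<oplus>\<^bsub>M\<^esub> (\<Oplus>\<^bsub>M\<^esub>s\<in>T. c s \<odot>\<^bsub>M\<^esub> s)"
      using insert.prems insert.hyps SM by (intro M.finsum_insert) (auto simp: Pi_def subset_iff)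
    ultimately show ?case using insert add by auto
  qed (simp add: assms)
  with x show "x \<in> N" by simp
qed

lemma module_span_base:
  assumes "S \<subseteq> carrier M" "s \<in> S"
  shows "s \<in> module_span R M S"
proof -
  have "(\<Oplus>\<^bsub>M\<^esub>t\<in>{s}. \<one> \<odot>\<^bsub>M\<^esub> t) = s"
    using assms by (subst M.finsum_insert) auto
  then show ?thesis
    unfolding module_span_def using assms
    by (intro CollectI exI[of _ "\<lambda>_. \<one>"] exI[of _ "{s}"]) auto
qed

lemma module_span_zero: "\<zero>\<^bsub>M\<^esub> \<in> module_span R M S"
  unfolding module_span_def by (intro CollectI exI[of _ "\<lambda>_. \<one>"] exI[of _ "{}"]) auto

lemma module_span_smult:
  assumes S: "S \<subseteq> carrier M" and a: "a \<in> carrier R" and x: "x \<in> module_span R M S"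
  shows "a \<odot>\<^bsub>M\<^esub> x \<in> module_span R M S"
proof -
  from x obtain c T where T: "finite T" "T \<subseteq> S" "c \<in> T \<rightarrow> carrier R"
    and x: "x = (\<Oplus>\<^bsub>M\<^esub>s\<in>T. c s \<odot>\<^bsub>M\<^esub> s)"
    unfolding module_span_def by blast
  have "a \<odot>\<^bsub>M\<^esub> x = (\<Oplus>\<^bsub>M\<^esub>s\<in>T. a \<odot>\<^bsub>M\<^esub> (c s \<odot>\<^bsub>M\<^esub> s))"
    unfolding x using T S a by (intro finsum_smult_ldistr) (auto simp: Pi_def)
  also have "\<dots> = (\<Oplus>\<^bsub>M\<^esub>s\<in>T. (a \<otimes> c s) \<odot>\<^bsub>M\<^esub> s)"
    using T S a by (intro M.finsum_cong') (auto simp: smult_assoc1 Pi_def subset_iff)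
  finally show ?thesis
    unfolding module_span_def using T a by (intro CollectI exI[of _ "\<lambda>s. a \<otimes> c s"] exI[of _ T]) auto
qed

lemma module_span_add:
  assumes S: "S \<subseteq> carrier M" and x: "x \<in> module_span R M S" and y: "y \<in> module_span R M S"
  shows "x \<oplus>\<^bsub>M\<^esub> y \<in> module_span R M S"
proof -
  have extend: "\<exists>c'. c' \<in> U \<rightarrow> carrier R \<and> (\<Oplus>\<^bsub>M\<^esub>s\<in>T. c s \<odot>\<^bsub>M\<^esub> s) = (\<Oplus>\<^bsub>M\<^esub>s\<in>U. c' s \<odot>\<^bsub>M\<^esub> s)"
    if "finite U" "T \<subseteq> U" "U \<subseteq> S" "c \<in> T \<rightarrow> carrier R" for c T U
    using that S
    by (intro exI[of _ "\<lambda>s. if s \<in> T then c s else \<zero>"] conjI M.add.finprod_mono_neutral_cong_left)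
       (auto simp: Pi_def subset_iff)
  from x obtain c T where T: "finite T" "T \<subseteq> S" "c \<in> T \<rightarrow> carrier R"
    and x: "x = (\<Oplus>\<^bsub>M\<^esub>s\<in>T. c s \<odot>\<^bsub>M\<^esub> s)"
    unfolding module_span_def by blast
  from y obtain d U where U: "finite U" "U \<subseteq> S" "d \<in> U \<rightarrow> carrier R"
    and y: "y = (\<Oplus>\<^bsub>M\<^esub>s\<in>U. d s \<odot>\<^bsub>M\<^esub> s)"
    unfolding module_span_def by blast
  obtain c' where c': "c' \<in> T \<union> U \<rightarrow> carrier R" "x = (\<Oplus>\<^bsub>M\<^esub>s\<in>T \<union> U. c' s \<odot>\<^bsub>M\<^esub> s)"
    using extend[of "T \<union> U" T c] T U x by auto
  obtain d' where d': "d' \<in> T \<union> U \<rightarrow> carrier R" "y = (\<Oplus>\<^bsub>M\<^esub>s\<in>T \<union> U. d' s \<odot>\<^bsub>M\<^esub> s)"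
    using extend[of "T \<union> U" U d] T U y by auto
  have TU: "T \<union> U \<subseteq> carrier M" using T U S by auto
  have "x \<oplus>\<^bsub>M\<^esub> y = (\<Oplus>\<^bsub>M\<^esub>s\<in>T \<union> U. c' s \<odot>\<^bsub>M\<^esub> s \<oplus>\<^bsub>M\<^esub> d' s \<odot>\<^bsub>M\<^esub> s)"
    unfolding c'(2) d'(2) using c'(1) d'(1) TU
    by (intro M.finsum_addf[symmetric]) (auto simp: Pi_def subset_iff)
  also have "\<dots> = (\<Oplus>\<^bsub>M\<^esub>s\<in>T \<union> U. (c' s \<oplus> d' s) \<odot>\<^bsub>M\<^esub> s)"
    using c'(1) d'(1) TU by (intro M.finsum_cong') (auto simp: Pi_def subset_iff smult_l_distr)
  finally show ?thesis
    unfolding module_span_def using T U c'(1) d'(1)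
    by (intro CollectI exI[of _ "\<lambda>s. c' s \<oplus> d' s"] exI[of _ "T \<union> U"]) (auto simp: Pi_def)
qed

end

definition generated_filtration ::
  "'r ring \<Rightarrow> ('r, 'm) module \<Rightarrow> 'm set \<Rightarrow> nat \<Rightarrow> 'm set" where
  "generated_filtration R M S p =
     module_span R M {foldr (mult M) hs \<one>\<^bsub>M\<^esub> | hs. length hs \<le> p \<and> set hs \<subseteq> S}"

context plain_algebra begin

lemma foldr_mult_closed: "set hs \<subseteq> carrier M \<Longrightarrow> foldr (mult M) hs \<one>\<^bsub>M\<^esub> \<in> carrier M"
  by (induction hs) auto

context
  fixes S assumes S: "S \<subseteq> carrier M"
begin

lemma products_closed: "{foldr (mult M) hs \<one>\<^bsub>M\<^esub> | hs. length hs \<le> p \<and> set hs \<subseteq> S} \<subseteq> carrier M"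
  using S by (auto intro!: foldr_mult_closed)

lemma generated_filtration_closed: "generated_filtration R M S p \<subseteq> carrier M"
  unfolding generated_filtration_def by (intro module_span_closed products_closed)

lemma generated_filtration_zero: "\<zero>\<^bsub>M\<^esub> \<in> generated_filtration R M S p"
  unfolding generated_filtration_def by (rule module_span_zero)

lemma generated_filtration_add:
  "x \<in> generated_filtration R M S p \<Longrightarrow> y \<in> generated_filtration R M S p \<Longrightarrow>
   x \<oplus>\<^bsub>M\<^esub> y \<in> generated_filtration R M S p"
  unfolding generated_filtration_def by (rule module_span_add[OF products_closed])

lemma generated_filtration_smult:
  "a \<in> carrier R \<Longrightarrow> x \<in> generated_filtration R M S p \<Longrightarrow> a \<odot>\<^bsub>M\<^esub> x \<in> generated_filtration R M S p"
  unfolding generated_filtration_def by (rule module_span_smult[OF products_closed])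

lemma generated_filtration_minus:
  assumes "x \<in> generated_filtration R M S p" "y \<in> generated_filtration R M S p"
  shows "x \<ominus>\<^bsub>M\<^esub> y \<in> generated_filtration R M S p"
proof -
  have carr: "x \<in> carrier M" "y \<in> carrier M" using assms generated_filtration_closed by auto
  then have "x \<ominus>\<^bsub>M\<^esub> y = x \<oplus>\<^bsub>M\<^esub> (\<ominus> \<one>) \<odot>\<^bsub>M\<^esub> y"
    by (simp add: smult_l_minus a_minus_def)
  then show ?thesis
    using assms by (simp add: generated_filtration_add generated_filtration_smult)
qed

lemma generated_filtration_product:
  "length hs \<le> p \<Longrightarrow> set hs \<subseteq> S \<Longrightarrow> foldr (mult M) hs \<one>\<^bsub>M\<^esub> \<in> generated_filtration R M S p"
  unfolding generated_filtration_def by (rule module_span_base[OF products_closed]) auto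

lemma generated_filtration_one: "\<one>\<^bsub>M\<^esub> \<in> generated_filtration R M S p"
  using generated_filtration_product[of "[]" p] by simp

lemma generated_filtration_generator: "h \<in> S \<Longrightarrow> h \<in> generated_filtration R M S 1"
  using generated_filtration_product[of "[h]" 1] S by auto

lemma generated_filtration_minimal:
  assumes "\<And>hs. length hs \<le> p \<Longrightarrow> set hs \<subseteq> S \<Longrightarrow> foldr (mult M) hs \<one>\<^bsub>M\<^esub> \<in> N"
    and "N \<subseteq> carrier M" "\<zero>\<^bsub>M\<^esub> \<in> N"
    and "\<And>x y. x \<in> N \<Longrightarrow> y \<in> N \<Longrightarrow> x \<oplus>\<^bsub>M\<^esub> y \<in> N"
    and "\<And>a x. a \<in> carrier R \<Longrightarrow> x \<in> N \<Longrightarrow> a \<odot>\<^bsub>M\<^esub> x \<in> N"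
  shows "generated_filtration R M S p \<subseteq> N"
  unfolding generated_filtration_def by (rule module_span_minimal) (use assms in auto)

lemma generated_filtration_mono:
  assumes "p \<le> q" shows "generated_filtration R M S p \<subseteq> generated_filtration R M S q"
  by (rule generated_filtration_minimal)
     (use assms generated_filtration_closed in
       \<open>auto intro: generated_filtration_product generated_filtration_zero
          generated_filtration_add generated_filtration_smult\<close>)

text \<open>
  The filtration is multiplicative.  Fixing one factor turns the claim into a containment of a span
  in a submodule, so it only has to be checked on generators, first for the left factor and then
  for the right one.
\<close>

lemma generated_filtration_mult:
  assumes f: "f \<in> generated_filtration R M S 1" and g: "g \<in> generated_filtration R M S p"
  shows "f \<otimes>\<^bsub>M\<^esub> g \<in> generated_filtration R M S (Suc p)"
proof -
  let ?F = "generated_filtration R M S"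
  have gen: "h \<otimes>\<^bsub>M\<^esub> g \<in> ?F (Suc p)" if h: "h \<in> S" for h
  proof -
    have hc: "h \<in> carrier M" using h S by auto
    have "?F p \<subseteq> {g \<in> carrier M. h \<otimes>\<^bsub>M\<^esub> g \<in> ?F (Suc p)}"
    proof (rule generated_filtration_minimal)
      fix hs assume hs: "length hs \<le> p" "set hs \<subseteq> S"
      then show "foldr (mult M) hs \<one>\<^bsub>M\<^esub> \<in> {g \<in> carrier M. h \<otimes>\<^bsub>M\<^esub> g \<in> ?F (Suc p)}"
        using generated_filtration_product[of "h # hs" "Suc p"] h S
        by (auto intro!: foldr_mult_closed)
    next
      fix a x assume "a \<in> carrier R" "x \<in> {g \<in> carrier M. h \<otimes>\<^bsub>M\<^esub> g \<in> ?F (Suc p)}"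
      moreover from this hc have "h \<otimes>\<^bsub>M\<^esub> (a \<odot>\<^bsub>M\<^esub> x) = a \<odot>\<^bsub>M\<^esub> (h \<otimes>\<^bsub>M\<^esub> x)"
        using m_comm[of h "a \<odot>\<^bsub>M\<^esub> x"] m_comm[of h x] by (auto simp: smult_assoc2)
      ultimately show "a \<odot>\<^bsub>M\<^esub> x \<in> {g \<in> carrier M. h \<otimes>\<^bsub>M\<^esub> g \<in> ?F (Suc p)}"
        by (auto intro: generated_filtration_smult)
    qed (use hc in \<open>auto simp: r_distr intro: generated_filtration_zero generated_filtration_add\<close>)
    with g show ?thesis by auto
  qed
  have gc: "g \<in> carrier M" using g generated_filtration_closed by auto
  have "?F 1 \<subseteq> {f \<in> carrier M. f \<otimes>\<^bsub>M\<^esub> g \<in> ?F (Suc p)}"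
  proof (rule generated_filtration_minimal)
    fix hs assume hs: "length hs \<le> 1" "set hs \<subseteq> S"
    then consider "hs = []" | h where "hs = [h]" "h \<in> S" by (cases hs) auto
    then show "foldr (mult M) hs \<one>\<^bsub>M\<^esub> \<in> {f \<in> carrier M. f \<otimes>\<^bsub>M\<^esub> g \<in> ?F (Suc p)}"
      by cases (use g gc gen S generated_filtration_mono[of p "Suc p"] in auto)
  qed (use gc in \<open>auto simp: l_distr smult_assoc2
        intro: generated_filtration_zero generated_filtration_add generated_filtration_smult\<close>)
  with f show ?thesis by auto
qed

end

end

text \<open>
  An algebra homomorphism respects the filtrations as soon as it sends generators to degree one:
  all higher pieces follow by multiplicativity.
\<close>

lemma generated_filtration_image:
  assumes "algebra R M" "algebra R N" and S: "S \<subseteq> carrier M" and T: "T \<subseteq> carrier N"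
    and hom: "\<phi> \<in> ring_hom M N"
    and lin: "\<And>a f. a \<in> carrier R \<Longrightarrow> f \<in> carrier M \<Longrightarrow> \<phi> (a \<odot>\<^bsub>M\<^esub> f) = a \<odot>\<^bsub>N\<^esub> \<phi> f"
    and gen: "\<And>s. s \<in> S \<Longrightarrow> \<phi> s \<in> generated_filtration R N T 1"
  shows "\<phi> ` generated_filtration R M S p \<subseteq> generated_filtration R N T p"
proof -
  interpret M: plain_algebra R M by (rule plain_algebra.intro) fact
  interpret N: plain_algebra R N by (rule plain_algebra.intro) fact
  have prod: "\<phi> (foldr (mult M) hs \<one>\<^bsub>M\<^esub>) \<in> generated_filtration R N T (length hs)"
    if "set hs \<subseteq> S" for hs
    using that
  proof (induction hs)
    case Nil
    then show ?case
      using N.generated_filtration_one[OF T] ring_hom_one[OF hom] by simp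
  next
    case (Cons h hs)
    have "\<phi> (h \<otimes>\<^bsub>M\<^esub> foldr (mult M) hs \<one>\<^bsub>M\<^esub>) = \<phi> h \<otimes>\<^bsub>N\<^esub> \<phi> (foldr (mult M) hs \<one>\<^bsub>M\<^esub>)"
      using Cons.prems S by (intro ring_hom_mult[OF hom] M.foldr_mult_closed) auto
    with Cons gen N.generated_filtration_mult[OF T] show ?case by simp
  qed
  have "generated_filtration R M S p \<subseteq> {f \<in> carrier M. \<phi> f \<in> generated_filtration R N T p}"
  proof (rule M.generated_filtration_minimal[OF S])
    fix hs assume "length hs \<le> p" "set hs \<subseteq> S"
    then show "foldr (mult M) hs \<one>\<^bsub>M\<^esub> \<in> {f \<in> carrier M. \<phi> f \<in> generated_filtration R N T p}"
      using prod[of hs] N.generated_filtration_mono[OF T, of "length hs" p] S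
      by (auto intro!: M.foldr_mult_closed)
  next
    show "\<zero>\<^bsub>M\<^esub> \<in> {f \<in> carrier M. \<phi> f \<in> generated_filtration R N T p}"
      using ring_hom_zero[OF hom cring.axioms(1)[OF M.M_cring] cring.axioms(1)[OF N.M_cring]] N.generated_filtration_zero[OF T] by simp
  qed (use ring_hom_add[OF hom] lin in
      \<open>auto intro: N.generated_filtration_add[OF T] N.generated_filtration_smult[OF T]\<close>)
  then show ?thesis by auto
qed

lemma filtered_algebra_isomorphicI:
  assumes M: "algebra R M" and N: "algebra R N" and S: "S \<subseteq> carrier M" and T: "T \<subseteq> carrier N"
    and hom: "\<phi> \<in> ring_hom M N" "\<psi> \<in> ring_hom N M"
    and inv: "\<And>f. f \<in> carrier M \<Longrightarrow> \<psi> (\<phi> f) = f" "\<And>g. g \<in> carrier N \<Longrightarrow> \<phi> (\<psi> g) = g"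
    and lin: "\<And>a f. a \<in> carrier R \<Longrightarrow> f \<in> carrier M \<Longrightarrow> \<phi> (a \<odot>\<^bsub>M\<^esub> f) = a \<odot>\<^bsub>N\<^esub> \<phi> f"
      "\<And>a g. a \<in> carrier R \<Longrightarrow> g \<in> carrier N \<Longrightarrow> \<psi> (a \<odot>\<^bsub>N\<^esub> g) = a \<odot>\<^bsub>M\<^esub> \<psi> g"
    and gen: "\<And>s. s \<in> S \<Longrightarrow> \<phi> s \<in> generated_filtration R N T 1"
      "\<And>t. t \<in> T \<Longrightarrow> \<psi> t \<in> generated_filtration R M S 1"
  shows "filtered_algebra_isomorphic R M (generated_filtration R M S) N (generated_filtration R N T)"
proof -
  have "bij_betw \<phi> (carrier M) (carrier N)"
    by (rule bij_betw_byWitness[of _ \<psi>]) (use inv hom in \<open>auto simp: ring_hom_def\<close>)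
  then have iso: "\<phi> \<in> ring_iso M N" using hom by (simp add: ring_iso_def)
  have "\<phi> ` generated_filtration R M S p = generated_filtration R N T p" for p
  proof
    show "\<phi> ` generated_filtration R M S p \<subseteq> generated_filtration R N T p"
      by (rule generated_filtration_image[OF M N S T hom(1) lin(1) gen(1)])
    have "\<psi> ` generated_filtration R N T p \<subseteq> generated_filtration R M S p"
      by (rule generated_filtration_image[OF N M T S hom(2) lin(2) gen(2)])
    then show "generated_filtration R N T p \<subseteq> \<phi> ` generated_filtration R M S p"
      using inv(2) plain_algebra.generated_filtration_closed[OF plain_algebra.intro[OF N] T, of p] by force
  qed
  with iso lin(1) show ?thesis unfolding filtered_algebra_isomorphic_def by blast
qed

section \<open>Relabelling the chambers\<close>

definition heavisides :: "'v::real_normed_vector set \<Rightarrow> 'v set set \<Rightarrow> 'r ring \<Rightarrow> ('v set \<Rightarrow> 'r) set" where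
  "heavisides V A R = {heaviside V A R \<alpha> | \<alpha>. \<exists>H\<in>A. defining_form V H \<alpha>}"

lemma VG_filtration_eq:
  "VG_filtration V A R = generated_filtration R (VG V A R) (heavisides V A R)"
  by (rule ext) (simp add: VG_filtration_def generated_filtration_def heavisides_def)

lemma VG_simps:
  "carrier (VG V A R) = chambers V A \<rightarrow>\<^sub>E carrier R"
  "mult (VG V A R) f g = (\<lambda>C\<in>chambers V A. f C \<otimes>\<^bsub>R\<^esub> g C)"
  "\<one>\<^bsub>VG V A R\<^esub> = (\<lambda>C\<in>chambers V A. \<one>\<^bsub>R\<^esub>)"
  "\<zero>\<^bsub>VG V A R\<^esub> = (\<lambda>C\<in>chambers V A. \<zero>\<^bsub>R\<^esub>)"
  "add (VG V A R) f g = (\<lambda>C\<in>chambers V A. f C \<oplus>\<^bsub>R\<^esub> g C)"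
  "a \<odot>\<^bsub>VG V A R\<^esub> f = (\<lambda>C\<in>chambers V A. a \<otimes>\<^bsub>R\<^esub> f C)"
  by (simp_all add: VG_def)

lemma VG_algebra:
  assumes "cring R" shows "algebra R (VG V A R)"
proof -
  interpret R: cring R by fact
  note pointwise = VG_simps PiE_iff extensional_def fun_eq_iff
  have group: "abelian_group (VG V A R)"
  proof (rule abelian_groupI, goal_cases)
    case (6 x)
    then show ?case
      by (intro bexI[of _ "\<lambda>C\<in>chambers V A. \<ominus>\<^bsub>R\<^esub> x C"]) (auto simp: pointwise R.l_neg)
  qed (auto simp: pointwise R.a_ac)
  have monoid: "Group.comm_monoid (VG V A R)"
    by (rule comm_monoidI) (auto simp: pointwise R.m_ac)
  have ring: "cring (VG V A R)"
    by (rule cringI[OF group monoid]) (auto simp: pointwise R.l_distr)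
  show ?thesis
    by (rule algebraI[OF assms ring]) (auto simp: pointwise R.l_distr R.r_distr R.m_assoc)
qed

lemma heavisides_closed: "cring R \<Longrightarrow> heavisides V A R \<subseteq> carrier (VG V A R)"
  by (auto simp: heavisides_def heaviside_def VG_simps cring.cring_simprules)

lemma pullback_ring_hom:
  assumes "cring R" "b \<in> chambers W B \<rightarrow> chambers V A"
  shows "(\<lambda>f. \<lambda>D\<in>chambers W B. f (b D)) \<in> ring_hom (VG V A R) (VG W B R)"
  using assms by (intro ring_hom_memI) (auto simp: VG_simps Pi_def fun_eq_iff PiE_iff)

text \<open>
  Every relabelling of the chambers is an isomorphism of algebras of functions; the filtration is
  the only thing that can go wrong, and degree one decides about it.
\<close>

lemma VG_isomorphicI:
  assumes R: "cring R"
    and b: "b \<in> chambers W B \<rightarrow> chambers V A" "d \<in> chambers V A \<rightarrow> chambers W B"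
    and inv: "\<And>C. C \<in> chambers V A \<Longrightarrow> b (d C) = C" "\<And>D. D \<in> chambers W B \<Longrightarrow> d (b D) = D"
    and gen: "\<And>h. h \<in> heavisides V A R \<Longrightarrow> (\<lambda>D\<in>chambers W B. h (b D)) \<in> VG_filtration W B R 1"
      "\<And>h. h \<in> heavisides W B R \<Longrightarrow> (\<lambda>C\<in>chambers V A. h (d C)) \<in> VG_filtration V A R 1"
  shows "VG_isomorphic R V A W B"
  unfolding VG_isomorphic_def VG_filtration_eq
proof (rule filtered_algebra_isomorphicI)
  show "(\<lambda>f. \<lambda>D\<in>chambers W B. f (b D)) \<in> ring_hom (VG V A R) (VG W B R)"
    "(\<lambda>g. \<lambda>C\<in>chambers V A. g (d C)) \<in> ring_hom (VG W B R) (VG V A R)"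
    using R b by (auto intro: pullback_ring_hom)
  note pointwise = VG_simps PiE_iff extensional_def fun_eq_iff Pi_def
  show "(\<lambda>C\<in>chambers V A. (\<lambda>D\<in>chambers W B. f (b D)) (d C)) = f"
    if "f \<in> carrier (VG V A R)" for f
    using that b inv by (auto simp: pointwise)
  show "(\<lambda>D\<in>chambers W B. (\<lambda>C\<in>chambers V A. g (d C)) (b D)) = g"
    if "g \<in> carrier (VG W B R)" for g
    using that b inv by (auto simp: pointwise)
  show "(\<lambda>D\<in>chambers W B. (a \<odot>\<^bsub>VG V A R\<^esub> f) (b D)) =
      a \<odot>\<^bsub>VG W B R\<^esub> (\<lambda>D\<in>chambers W B. f (b D))" for a f
    using b by (auto simp: pointwise)
  show "(\<lambda>C\<in>chambers V A. (a \<odot>\<^bsub>VG W B R\<^esub> g) (d C)) =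
      a \<odot>\<^bsub>VG V A R\<^esub> (\<lambda>C\<in>chambers V A. g (d C))" for a g
    using b by (auto simp: pointwise)
qed (use R gen in \<open>auto simp: VG_algebra heavisides_closed VG_filtration_eq\<close>)

section \<open>Chambers as sign vectors\<close>

definition sign_vector :: "('v \<Rightarrow> real) list \<Rightarrow> 'v \<Rightarrow> bool list" where
  "sign_vector fs v = map (\<lambda>f. f v > 0) fs"

text \<open>
  An arrangement with one defining form chosen for each hyperplane.  The forms are listed, so that
  a chamber can be encoded by the list of the signs of these forms on it; the sign vectors that
  occur are the topes of the arrangement.
\<close>

locale form_arrangement =
  fixes V :: "'v::real_normed_vector set" and fs :: "('v \<Rightarrow> real) list"
  assumes subspace: "subspace V"
    and form_linear: "f \<in> set fs \<Longrightarrow> linear f"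
    and form_continuous: "f \<in> set fs \<Longrightarrow> continuous_on V f"
    and form_nonzero: "f \<in> set fs \<Longrightarrow> \<exists>v\<in>V. f v \<noteq> 0"
    and hyperplanes_distinct: "distinct (map (linear_hyperplane V) fs)"
begin

definition hyperplanes :: "'v set set" where
  "hyperplanes = linear_hyperplane V ` set fs"

definition topes :: "bool list set" where
  "topes = sign_vector fs ` complement V hyperplanes"

definition cell :: "bool list \<Rightarrow> 'v set" where
  "cell t = {v \<in> complement V hyperplanes. sign_vector fs v = t}"

lemma in_complement_iff: "v \<in> complement V hyperplanes \<longleftrightarrow> v \<in> V \<and> (\<forall>f\<in>set fs. f v \<noteq> 0)"
  by (auto simp: complement_def hyperplanes_def linear_hyperplane_def)

lemma length_tope: "t \<in> topes \<Longrightarrow> length t = length fs"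
  by (auto simp: topes_def sign_vector_def)

lemma cell_nonempty: "t \<in> topes \<Longrightarrow> cell t \<noteq> {}"
  by (auto simp: topes_def cell_def)

lemma cell_disjoint: "x \<in> cell s \<Longrightarrow> x \<in> cell t \<Longrightarrow> s = t"
  by (auto simp: cell_def)

lemma inj_on_cell: "inj_on cell topes"
proof (rule inj_onI)
  fix s t assume "s \<in> topes" "cell s = cell t"
  moreover from this obtain x where "x \<in> cell s" using cell_nonempty by blast
  ultimately show "s = t" using cell_disjoint by metis
qed

lemma form_pos_on_cell:
  assumes "x \<in> cell t" "i < length fs"
  shows "(fs ! i) x > 0 \<longleftrightarrow> t ! i" "(fs ! i) x < 0 \<longleftrightarrow> \<not> t ! i"
proof -
  show *: "(fs ! i) x > 0 \<longleftrightarrow> t ! i"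
    using assms by (auto simp: cell_def sign_vector_def)
  have "(fs ! i) x \<noteq> 0"
    using assms by (auto simp: cell_def in_complement_iff)
  with * show "(fs ! i) x < 0 \<longleftrightarrow> \<not> t ! i" by linarith
qed

lemma cell_eq:
  assumes "t \<in> topes"
  shows "cell t = V \<inter> (\<Inter>i\<in>{..<length fs}. {v. if t ! i then (fs ! i) v > 0 else (fs ! i) v < 0})"
proof -
  have sign: "a \<noteq> 0 \<and> (a > 0 \<longleftrightarrow> b) \<longleftrightarrow> (if b then a > 0 else a < 0)" for a :: real and b by auto
  have "v \<in> cell t \<longleftrightarrow> v \<in> V \<and> (\<forall>i<length fs. (fs ! i) v \<noteq> 0 \<and> ((fs ! i) v > 0 \<longleftrightarrow> t ! i))" for v
    using length_tope[OF assms]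
    by (auto simp: cell_def in_complement_iff sign_vector_def list_eq_iff_nth_eq all_set_conv_all_nth)
  then show ?thesis unfolding sign by blast
qed

lemma convex_cell:
  assumes "t \<in> topes" shows "convex (cell t)"
proof -
  have "convex {v. if t ! i then (fs ! i) v > 0 else (fs ! i) v < 0}" if "i < length fs" for i
  proof -
    have "linear (fs ! i)" using that by (intro form_linear) simp
    then have "convex ((fs ! i) -` {0<..})" "convex ((fs ! i) -` {..<0})"
      by (auto intro!: convex_linear_vimage)
    then show ?thesis by (cases "t ! i") (auto simp: vimage_def)
  qed
  then show ?thesis
    unfolding cell_eq[OF assms]
    by (intro convex_Int convex_INT subspace_imp_convex[OF subspace]) (simp only: lessThan_iff)
qed

text \<open>
  A form that vanishes nowhere on a connected set has constant sign there, by the intermediate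
  value theorem.
\<close>

lemma connected_subset_cell:
  assumes C: "connected C" "C \<subseteq> complement V hyperplanes" and x: "x \<in> C"
  shows "C \<subseteq> cell (sign_vector fs x)"
proof
  fix y assume y: "y \<in> C"
  have "f x > 0 \<longleftrightarrow> f y > 0" if f: "f \<in> set fs" for f
  proof (rule ccontr)
    assume neq: "(f x > 0) \<noteq> (f y > 0)"
    have "connected (f ` C)"
      using C by (intro connected_continuous_image continuous_on_subset[OF form_continuous[OF f]])
        (auto simp: complement_def)
    moreover have "f x \<in> f ` C" "f y \<in> f ` C" using x y by auto
    ultimately have "0 \<in> f ` C"
      using neq by (metis connectedD_interval linorder_le_cases not_le order.strict_implies_order)
    then show False using C(2) f by (force simp: in_complement_iff)
  qed
  then show "y \<in> cell (sign_vector fs x)"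
    using C(2) y by (auto simp: cell_def sign_vector_def)
qed

text \<open>
  Cells are convex, hence connected, and no connected subset of the complement meets two of them.
\<close>

lemma chambers_eq: "chambers V hyperplanes = cell ` topes"
proof -
  have comp: "cell t \<in> components (complement V hyperplanes)" if t: "t \<in> topes" for t
    unfolding in_components_maximal
  proof (intro conjI allI impI)
    show "cell t \<noteq> {}" "connected (cell t)"
      using t by (auto simp: cell_nonempty convex_cell convex_connected)
    show "cell t \<subseteq> complement V hyperplanes" by (auto simp: cell_def)
    fix d assume d: "d \<noteq> {} \<and> cell t \<subseteq> d \<and> d \<subseteq> complement V hyperplanes \<and> connected d"
    obtain x where x: "x \<in> cell t" using cell_nonempty[OF t] by auto
    then have "d \<subseteq> cell (sign_vector fs x)" using d by (intro connected_subset_cell) auto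
    moreover have "sign_vector fs x = t" using x by (simp add: cell_def)
    ultimately show "d = cell t" using d by auto
  qed
  moreover have "C \<in> cell ` topes" if C: "C \<in> components (complement V hyperplanes)" for C
  proof -
    obtain x where x: "x \<in> C" using in_components_nonempty[OF C] by auto
    have sub: "C \<subseteq> complement V hyperplanes" by (rule in_components_subset[OF C])
    have "C \<subseteq> cell (sign_vector fs x)"
      using in_components_connected[OF C] sub x by (rule connected_subset_cell)
    moreover have t: "sign_vector fs x \<in> topes" using x sub by (auto simp: topes_def)
    ultimately have "C = cell (sign_vector fs x)"
      using C comp[OF t] unfolding in_components_maximal by blast
    with t show ?thesis by blast
  qed
  ultimately show ?thesis unfolding chambers_def by blast
qed

lemma cell_in_chambers: "t \<in> topes \<Longrightarrow> cell t \<in> chambers V hyperplanes"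
  by (simp add: chambers_eq)

lemma form_defining:
  assumes "i < length fs"
  shows "defining_form V (linear_hyperplane V (fs ! i)) (fs ! i)"
  using assms form_linear form_nonzero by (auto simp: defining_form_def)

text \<open>
  Two forms with the same kernel are proportional.  It is the reason why separation and the set of
  Heaviside functions, which quantify over all defining forms, can be read off the chosen ones.
\<close>

lemma defining_form_multiple:
  assumes i: "i < length fs" and \<beta>: "defining_form V (linear_hyperplane V (fs ! i)) \<beta>"
  obtains c where "c \<noteq> 0" "\<And>v. v \<in> V \<Longrightarrow> \<beta> v = c * (fs ! i) v"
proof -
  let ?f = "fs ! i"
  have lin: "linear ?f" "linear \<beta>" and ker: "\<And>v. v \<in> V \<Longrightarrow> ?f v = 0 \<longleftrightarrow> \<beta> v = 0"
    using i \<beta> form_linear by (auto simp: defining_form_def linear_hyperplane_def set_eq_iff)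
  obtain w where w: "w \<in> V" "?f w \<noteq> 0" using form_nonzero[of ?f] i by auto
  have "\<beta> v = \<beta> w / ?f w * ?f v" if v: "v \<in> V" for v
  proof -
    have "v - (?f v / ?f w) *\<^sub>R w \<in> V"
      using subspace v w by (intro subspace_diff subspace_scale)
    moreover have "?f (v - (?f v / ?f w) *\<^sub>R w) = 0"
      using w by (simp add: linear_diff[OF lin(1)] linear_cmul[OF lin(1)])
    ultimately have "\<beta> (v - (?f v / ?f w) *\<^sub>R w) = 0" using ker by blast
    then show ?thesis by (simp add: linear_diff[OF lin(2)] linear_cmul[OF lin(2)] field_simps)
  qed
  moreover have "\<beta> w / ?f w \<noteq> 0" using w ker by simp
  ultimately show ?thesis using that by blast
qed

lemma separates_cells_iff:
  assumes i: "i < length fs" and s: "s \<in> topes" and t: "t \<in> topes"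
  shows "separates V (linear_hyperplane V (fs ! i)) (cell s) (cell t) \<longleftrightarrow> s ! i \<noteq> t ! i"
proof
  assume "separates V (linear_hyperplane V (fs ! i)) (cell s) (cell t)"
  then obtain \<beta> where \<beta>: "defining_form V (linear_hyperplane V (fs ! i)) \<beta>"
      "\<And>x. x \<in> cell s \<Longrightarrow> \<beta> x > 0" "\<And>x. x \<in> cell t \<Longrightarrow> \<beta> x < 0"
    unfolding separates_def by blast
  obtain c where c: "c \<noteq> 0" "\<And>v. v \<in> V \<Longrightarrow> \<beta> v = c * (fs ! i) v"
    using defining_form_multiple[OF i \<beta>(1)] by blast
  obtain x y where xy: "x \<in> cell s" "y \<in> cell t" using cell_nonempty s t by blast
  then have "c * (fs ! i) x > 0" "c * (fs ! i) y < 0"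
    using \<beta>(2)[of x] \<beta>(3)[of y] c(2) by (auto simp: cell_def in_complement_iff)
  then have "((fs ! i) x > 0) \<noteq> ((fs ! i) y > 0)"
    by (auto simp: zero_less_mult_iff mult_less_0_iff)
  then show "s ! i \<noteq> t ! i" using form_pos_on_cell(1)[OF xy(1) i] form_pos_on_cell(1)[OF xy(2) i] by simp
next
  have def: "defining_form V (linear_hyperplane V (fs ! i)) (fs ! i)"
    "defining_form V (linear_hyperplane V (fs ! i)) (\<lambda>v. - (fs ! i) v)"
    using form_defining[OF i] by (auto simp: defining_form_def linear_hyperplane_def linear_compose_neg)
  assume "s ! i \<noteq> t ! i"
  then have "(\<forall>x\<in>cell s. (fs ! i) x > 0) \<and> (\<forall>x\<in>cell t. (fs ! i) x < 0) \<or>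
      (\<forall>x\<in>cell s. - (fs ! i) x > 0) \<and> (\<forall>x\<in>cell t. - (fs ! i) x < 0)"
    using form_pos_on_cell[OF _ i] by auto
  then show "separates V (linear_hyperplane V (fs ! i)) (cell s) (cell t)"
    unfolding separates_def using def by blast
qed

lemma card_separating:
  assumes "s \<in> topes" "t \<in> topes"
  shows "card {H \<in> hyperplanes. separates V H (cell s) (cell t)} =
    card {i. i < length fs \<and> s ! i \<noteq> t ! i}"
proof -
  let ?H = "\<lambda>i. linear_hyperplane V (fs ! i)"
  have "{H \<in> hyperplanes. separates V H (cell s) (cell t)} = ?H ` {i. i < length fs \<and> s ! i \<noteq> t ! i}"
    using separates_cells_iff[OF _ assms] by (force simp: hyperplanes_def in_set_conv_nth)
  moreover have "inj_on ?H {i. i < length fs \<and> s ! i \<noteq> t ! i}"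
    using hyperplanes_distinct by (auto simp: inj_on_def distinct_conv_nth)
  ultimately show ?thesis by (simp add: card_image)
qed

lemma central:
  assumes "finite B" "V = span B"
  shows "central_arrangement V hyperplanes"
proof -
  have "\<exists>\<alpha>. defining_form V H \<alpha>" if "H \<in> hyperplanes" for H
    using that form_defining by (force simp: hyperplanes_def in_set_conv_nth)
  moreover have "\<exists>B. finite B \<and> V = span B" using assms by blast
  ultimately show ?thesis
    using subspace by (simp add: central_arrangement_def) (simp add: hyperplanes_def)
qed

section \<open>Degrees in the tope graph\<close>

text \<open>
  The walls of a chamber: hyperplanes across which the sign vector remains realisable.
\<close>

definition flips :: "bool list \<Rightarrow> nat set" where
  "flips t = {i. i < length fs \<and> t[i := \<not> t ! i] \<in> topes}"

lemma tope_edge_iff: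
  assumes "s \<in> topes" "t \<in> topes"
  shows "{cell s, cell t} \<in> edges (tope_graph V hyperplanes) \<longleftrightarrow>
    card {i. i < length fs \<and> s ! i \<noteq> t ! i} = 1"
proof -
  have sym: "card {i. i < length fs \<and> t ! i \<noteq> s ! i} = card {i. i < length fs \<and> s ! i \<noteq> t ! i}"
    by (rule arg_cong[where f = card]) auto
  have "{cell s, cell t} \<in> edges (tope_graph V hyperplanes) \<longleftrightarrow>
      (\<exists>s'\<in>topes. \<exists>t'\<in>topes. {cell s, cell t} = {cell s', cell t'} \<and>
         card {H \<in> hyperplanes. separates V H (cell s') (cell t')} = 1)"
  proof -
    have "(\<exists>C D. Q C D \<and> C \<in> cell ` topes \<and> D \<in> cell ` topes \<and> P C D) \<longleftrightarrow>
        (\<exists>s'\<in>topes. \<exists>t'\<in>topes. Q (cell s') (cell t') \<and> P (cell s') (cell t'))"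
      for Q P :: "'v set \<Rightarrow> 'v set \<Rightarrow> bool" by blast
    then show ?thesis by (simp only: tope_graph_def chambers_eq graph.simps mem_Collect_eq)
  qed
  also have "\<dots> \<longleftrightarrow> (\<exists>s'\<in>topes. \<exists>t'\<in>topes. {cell s, cell t} = {cell s', cell t'} \<and>
         card {i. i < length fs \<and> s' ! i \<noteq> t' ! i} = 1)"
    by (intro bex_cong refl) (simp add: card_separating)
  also have "\<dots> \<longleftrightarrow> card {i. i < length fs \<and> s ! i \<noteq> t ! i} = 1"
    using assms sym inj_on_eq_iff[OF inj_on_cell] by (auto simp: doubleton_eq_iff)
  finally show ?thesis .
qed

lemma flip_iff:
  assumes "length s = n" "length t = n"
  shows "card {i. i < n \<and> s ! i \<noteq> t ! i} = 1 \<longleftrightarrow> (\<exists>i<n. t = s[i := \<not> s ! i])"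
proof
  assume "card {i. i < n \<and> s ! i \<noteq> t ! i} = 1"
  then obtain i where i: "{i. i < n \<and> s ! i \<noteq> t ! i} = {i}" by (rule card_1_singletonE)
  have differ: "t ! j = (if j = i then \<not> s ! j else s ! j)" if "j < n" for j
  proof -
    have "j < n \<and> s ! j \<noteq> t ! j \<longleftrightarrow> j = i" using i by (simp add: set_eq_iff)
    with that show ?thesis by auto
  qed
  then have "t = s[i := \<not> s ! i]"
    using assms by (intro nth_equalityI) (simp_all add: nth_list_update)
  with i show "\<exists>i<n. t = s[i := \<not> s ! i]" by auto
next
  assume "\<exists>i<n. t = s[i := \<not> s ! i]"
  then obtain i where "i < n" "t = s[i := \<not> s ! i]" by auto
  then have "{i. i < n \<and> s ! i \<noteq> t ! i} = {i}" using assms by (auto simp: nth_list_update)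
  then show "card {i. i < n \<and> s ! i \<noteq> t ! i} = 1" by simp
qed

lemma degree_cell:
  assumes t: "t \<in> topes"
  shows "vertex_degree (tope_graph V hyperplanes) (cell t) = card (flips t)"
proof -
  let ?E = "\<lambda>i. {cell t, cell (t[i := \<not> t ! i])}"
  have len: "length t = length fs" using t by (rule length_tope)
  have "{e \<in> edges (tope_graph V hyperplanes). cell t \<in> e} = ?E ` flips t"
  proof (intro equalityI subsetI)
    fix e assume e: "e \<in> {e \<in> edges (tope_graph V hyperplanes). cell t \<in> e}"
    then obtain s where s: "s \<in> topes" "e = {cell t, cell s}"
      by (auto simp: tope_graph_def chambers_eq)
    with e have "card {i. i < length fs \<and> t ! i \<noteq> s ! i} = 1" using tope_edge_iff t by auto
    then obtain i where "i < length fs" "s = t[i := \<not> t ! i]"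
      using flip_iff[OF len length_tope[OF s(1)]] by auto
    with s show "e \<in> ?E ` flips t" by (auto simp: flips_def)
  next
    fix e assume "e \<in> ?E ` flips t"
    then obtain i where i: "i < length fs" "t[i := \<not> t ! i] \<in> topes" "e = ?E i"
      by (auto simp: flips_def)
    then show "e \<in> {e \<in> edges (tope_graph V hyperplanes). cell t \<in> e}"
      using tope_edge_iff[OF t i(2)] flip_iff[OF len length_tope[OF i(2)]] by auto
  qed
  moreover have "inj_on ?E (flips t)"
  proof (rule inj_onI)
    fix i j assume ij: "i \<in> flips t" "j \<in> flips t" "?E i = ?E j"
    then have "cell (t[i := \<not> t ! i]) = cell (t[j := \<not> t ! j])" by (auto simp: doubleton_eq_iff)
    then have "t[i := \<not> t ! i] = t[j := \<not> t ! j]"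
      using ij inj_on_cell by (auto simp: flips_def inj_on_def)
    then have "t[i := \<not> t ! i] ! i = t[j := \<not> t ! j] ! i" by simp
    moreover have "i < length t" using ij(1) len by (simp add: flips_def)
    ultimately show "i = j" by (cases "i = j") simp_all
  qed
  ultimately show ?thesis by (simp add: vertex_degree_def card_image)
qed

lemma sign_vector_uminus:
  assumes "v \<in> complement V hyperplanes"
  shows "- v \<in> complement V hyperplanes" "sign_vector fs (- v) = map Not (sign_vector fs v)"
proof -
  have neg: "f (- v) = - f v" if "f \<in> set fs" for f using form_linear[OF that] by (rule linear_neg)
  show "- v \<in> complement V hyperplanes"
    unfolding in_complement_iff
  proof (intro conjI ballI)
    show "- v \<in> V" using assms by (simp add: in_complement_iff subspace_neg[OF subspace])
    fix f assume f: "f \<in> set fs"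
    then have "f v \<noteq> 0" using assms by (simp add: in_complement_iff)
    with neg[OF f] show "f (- v) \<noteq> 0" by linarith
  qed
  have "f (- v) > 0 \<longleftrightarrow> \<not> f v > 0" if "f \<in> set fs" for f
  proof -
    have "f v \<noteq> 0" using assms that by (simp add: in_complement_iff)
    with neg[OF that] show ?thesis by linarith
  qed
  then show "sign_vector fs (- v) = map Not (sign_vector fs v)"
    by (simp add: sign_vector_def)
qed

lemma topes_antipode:
  assumes "t \<in> topes" shows "map Not t \<in> topes"
proof -
  obtain v where v: "v \<in> complement V hyperplanes" "t = sign_vector fs v"
    using assms unfolding topes_def by blast
  show ?thesis
    unfolding topes_def v(2) sign_vector_uminus(2)[OF v(1), symmetric]
    by (rule imageI) (rule sign_vector_uminus(1)[OF v(1)])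
qed

lemma map_Not_Not: "map Not (map Not t) = t"
  by (simp add: comp_def)

lemma antipode_cell: "antipode (cell t) = cell (map Not t)"
proof -
  have neg: "- x \<in> cell (map Not s)" if "x \<in> cell s" for x s
    using that sign_vector_uminus[of x] by (simp add: cell_def)
  show ?thesis
  proof (intro equalityI subsetI)
    fix x assume "x \<in> antipode (cell t)"
    then show "x \<in> cell (map Not t)" using neg unfolding antipode_def by blast
  next
    fix x assume "x \<in> cell (map Not t)"
    from neg[OF this] have "- x \<in> cell t" unfolding map_Not_Not .
    then have "- (- x) \<in> antipode (cell t)" unfolding antipode_def by (rule imageI)
    then show "x \<in> antipode (cell t)" by simp
  qed
qed

lemma flips_antipode:
  assumes "t \<in> topes" shows "flips (map Not t) = flips t"
proof -
  have len: "length t = length fs" using assms by (rule length_tope)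
  have map: "(map Not t)[i := \<not> map Not t ! i] = map Not (t[i := \<not> t ! i])" if "i < length fs" for i
    using that len by (simp add: map_update)
  have "map Not s \<in> topes \<longleftrightarrow> s \<in> topes" for s
    using topes_antipode[of s] topes_antipode[of "map Not s"] unfolding map_Not_Not by blast
  with map show ?thesis unfolding flips_def by auto
qed

section \<open>Functions of degree one\<close>

definition tope_of :: "'v set \<Rightarrow> bool list" where
  "tope_of = the_inv_into topes cell"

lemma tope_of_cell: "t \<in> topes \<Longrightarrow> tope_of (cell t) = t"
  unfolding tope_of_def by (rule the_inv_into_f_f[OF inj_on_cell])

definition indicator_of :: "'r ring \<Rightarrow> (bool list \<Rightarrow> bool) \<Rightarrow> 'v set \<Rightarrow> 'r" where
  "indicator_of R P = (\<lambda>C\<in>chambers V hyperplanes. if P (tope_of C) then \<one>\<^bsub>R\<^esub> else \<zero>\<^bsub>R\<^esub>)"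

lemma restrict_chambers_eqI:
  assumes "\<And>t. t \<in> topes \<Longrightarrow> f (cell t) = g (cell t)"
  shows "(\<lambda>C\<in>chambers V hyperplanes. f C) = (\<lambda>C\<in>chambers V hyperplanes. g C)"
  unfolding chambers_eq using assms by (intro restrict_ext) blast

lemma pos_on_cell_iff:
  assumes "t \<in> topes" "i < length fs"
  shows "(\<forall>x\<in>cell t. (fs ! i) x > 0) \<longleftrightarrow> t ! i" "(\<forall>x\<in>cell t. (fs ! i) x < 0) \<longleftrightarrow> \<not> t ! i"
  using form_pos_on_cell[OF _ assms(2), of _ t] cell_nonempty[OF assms(1)] by auto

text \<open>
  A negative multiple of the chosen form contributes the complementary indicator.
\<close>

lemma heavisides_cases:
  assumes "h \<in> heavisides V hyperplanes R"
  obtains i where "i < length fs"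
    "h = indicator_of R (\<lambda>t. t ! i) \<or> h = indicator_of R (\<lambda>t. \<not> t ! i)"
proof -
  obtain \<beta> H where \<beta>: "H \<in> hyperplanes" "defining_form V H \<beta>" "h = heaviside V hyperplanes R \<beta>"
    using assms by (auto simp: heavisides_def)
  then obtain i where i: "i < length fs" "H = linear_hyperplane V (fs ! i)"
    by (auto simp: hyperplanes_def in_set_conv_nth)
  obtain c where c: "c \<noteq> 0" "\<And>v. v \<in> V \<Longrightarrow> \<beta> v = c * (fs ! i) v"
    using defining_form_multiple[OF i(1)] \<beta>(2) i(2) by blast
  have in_V: "x \<in> V" if "x \<in> cell t" for x t using that by (simp add: cell_def in_complement_iff)
  have pos: "(\<forall>x\<in>cell t. \<beta> x > 0) \<longleftrightarrow> (if c > 0 then t ! i else \<not> t ! i)" if t: "t \<in> topes" for t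
  proof (cases "c > 0")
    case True
    then have "(\<forall>x\<in>cell t. \<beta> x > 0) \<longleftrightarrow> (\<forall>x\<in>cell t. (fs ! i) x > 0)"
      using c(2) in_V by (auto simp: zero_less_mult_iff)
    with True pos_on_cell_iff[OF t i(1)] show ?thesis by simp
  next
    case False
    then have "(\<forall>x\<in>cell t. \<beta> x > 0) \<longleftrightarrow> (\<forall>x\<in>cell t. (fs ! i) x < 0)"
      using c in_V by (auto simp: zero_less_mult_iff)
    with False pos_on_cell_iff[OF t i(1)] show ?thesis by simp
  qed
  have "h = indicator_of R (\<lambda>t. if c > 0 then t ! i else \<not> t ! i)"
    unfolding \<beta>(3) heaviside_def indicator_of_def
    by (rule restrict_chambers_eqI) (simp only: pos tope_of_cell)
  then show ?thesis using that[OF i(1)] by (cases "c > 0") auto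
qed

lemma indicator_nth_degree_1:
  assumes R: "cring R" and i: "i < length fs"
  shows "indicator_of R (\<lambda>t. t ! i) \<in> VG_filtration V hyperplanes R 1"
proof -
  interpret plain_algebra R "VG V hyperplanes R"
    using R by (intro plain_algebra.intro VG_algebra)
  have "heaviside V hyperplanes R (fs ! i) \<in> heavisides V hyperplanes R"
  proof -
    have "linear_hyperplane V (fs ! i) \<in> hyperplanes" using i by (simp add: hyperplanes_def)
    then show ?thesis using form_defining[OF i] unfolding heavisides_def by blast
  qed
  moreover have "heaviside V hyperplanes R (fs ! i) = indicator_of R (\<lambda>t. t ! i)"
    unfolding heaviside_def indicator_of_def
    by (rule restrict_chambers_eqI) (simp only: pos_on_cell_iff(1) i tope_of_cell)
  ultimately show ?thesis
    unfolding VG_filtration_eq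
    using generated_filtration_generator[OF heavisides_closed[OF R]] by metis
qed

text \<open>
  The hypothesis is an identity between indicators over the natural numbers, \<open>P + t\<^sub>l = t\<^sub>j + t\<^sub>k\<close>,
  with values at most 2.  It therefore holds over every ring, in every characteristic, and exhibits
  the indicator of \<open>P\<close> as \<open>t\<^sub>j + t\<^sub>k - t\<^sub>l\<close>.
\<close>

lemma indicator_degree_1:
  assumes R: "cring R" and jkl: "j < length fs" "k < length fs" "l < length fs"
    and rel: "\<And>t. t \<in> topes \<Longrightarrow>
      of_bool (P t) + of_bool (t ! l) = (of_bool (t ! j) + of_bool (t ! k) :: nat)"
  shows "indicator_of R P \<in> VG_filtration V hyperplanes R 1"
proof -
  interpret plain_algebra R "VG V hyperplanes R"
    using R by (intro plain_algebra.intro VG_algebra)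
  let ?h = "\<lambda>i. indicator_of R (\<lambda>t. t ! i)"
  have carr: "indicator_of R Q \<in> carrier (VG V hyperplanes R)" for Q
    by (auto simp: indicator_of_def VG_simps)
  have rel': "(if P t then \<one>\<^bsub>R\<^esub> else \<zero>\<^bsub>R\<^esub>) \<oplus>\<^bsub>R\<^esub> (if t ! l then \<one>\<^bsub>R\<^esub> else \<zero>\<^bsub>R\<^esub>) =
      (if t ! j then \<one>\<^bsub>R\<^esub> else \<zero>\<^bsub>R\<^esub>) \<oplus>\<^bsub>R\<^esub> (if t ! k then \<one>\<^bsub>R\<^esub> else \<zero>\<^bsub>R\<^esub>)" if "t \<in> topes" for t
    using rel[OF that] by (auto split: if_splits)
  have "indicator_of R P \<oplus>\<^bsub>VG V hyperplanes R\<^esub> ?h l = ?h j \<oplus>\<^bsub>VG V hyperplanes R\<^esub> ?h k"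
    unfolding VG_simps
    by (rule restrict_chambers_eqI)
       (simp add: indicator_of_def cell_in_chambers tope_of_cell rel')
  then have "indicator_of R P = (?h j \<oplus>\<^bsub>VG V hyperplanes R\<^esub> ?h k) \<ominus>\<^bsub>VG V hyperplanes R\<^esub> ?h l"
    using carr by (metis M.minus_eq M.add.inv_solve_right M.add.m_closed)
  also have "\<dots> \<in> VG_filtration V hyperplanes R 1"
    unfolding VG_filtration_eq
    by (intro generated_filtration_minus generated_filtration_add heavisides_closed R
        indicator_nth_degree_1[unfolded VG_filtration_eq] jkl)
  finally show ?thesis .
qed

lemma indicator_not_degree_1:
  assumes R: "cring R" and P: "indicator_of R P \<in> VG_filtration V hyperplanes R 1"
  shows "indicator_of R (\<lambda>t. \<not> P t) \<in> VG_filtration V hyperplanes R 1"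
proof -
  interpret plain_algebra R "VG V hyperplanes R"
    using R by (intro plain_algebra.intro VG_algebra)
  have carr: "indicator_of R Q \<in> carrier (VG V hyperplanes R)" for Q
    by (auto simp: indicator_of_def VG_simps)
  have "indicator_of R (\<lambda>t. \<not> P t) \<oplus>\<^bsub>VG V hyperplanes R\<^esub> indicator_of R P = \<one>\<^bsub>VG V hyperplanes R\<^esub>"
    by (auto simp: VG_simps indicator_of_def fun_eq_iff)
  then have "indicator_of R (\<lambda>t. \<not> P t) = \<one>\<^bsub>VG V hyperplanes R\<^esub> \<ominus>\<^bsub>VG V hyperplanes R\<^esub> indicator_of R P"
    using carr by (metis M.minus_eq M.add.inv_solve_right one_closed)
  also have "\<dots> \<in> VG_filtration V hyperplanes R 1"
    using P unfolding VG_filtration_eq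
    by (intro generated_filtration_minus generated_filtration_one heavisides_closed R)
  finally show ?thesis .
qed

end

text \<open>
  The criterion for an indicator to have degree one, as a property of a set of sign vectors alone.
\<close>

definition three_term :: "bool list set \<Rightarrow> nat \<Rightarrow> (bool list \<Rightarrow> bool) \<Rightarrow> bool" where
  "three_term T n P \<longleftrightarrow> (\<exists>j<n. \<exists>k<n. \<exists>l<n. \<forall>t\<in>T.
     of_bool (P t) + of_bool (t ! l) = (of_bool (t ! j) + of_bool (t ! k) :: nat))"

lemma heaviside_pullback_degree_1:
  assumes V: "form_arrangement V fs" and W: "form_arrangement W gs" and R: "cring R"
    and \<kappa>: "\<kappa> \<in> form_arrangement.topes W gs \<rightarrow> form_arrangement.topes V fs"
    and rel: "\<And>i. i < length fs \<Longrightarrow> three_term (form_arrangement.topes W gs) (length gs) (\<lambda>t. \<kappa> t ! i)"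
    and h: "h \<in> heavisides V (form_arrangement.hyperplanes V fs) R"
  shows "(\<lambda>D\<in>chambers W (form_arrangement.hyperplanes W gs).
      h (form_arrangement.cell V fs (\<kappa> (form_arrangement.tope_of W gs D))))
    \<in> VG_filtration W (form_arrangement.hyperplanes W gs) R 1"
proof -
  interpret V: form_arrangement V fs by fact
  interpret W: form_arrangement W gs by fact
  have pull: "(\<lambda>D\<in>chambers W W.hyperplanes. V.indicator_of R P (V.cell (\<kappa> (W.tope_of D)))) =
      W.indicator_of R (\<lambda>t. P (\<kappa> t))" for P
    using \<kappa> by (auto simp: V.indicator_of_def W.indicator_of_def V.chambers_eq W.chambers_eq
        V.tope_of_cell W.tope_of_cell fun_eq_iff Pi_def)
  obtain i where i: "i < length fs"
    "h = V.indicator_of R (\<lambda>t. t ! i) \<or> h = V.indicator_of R (\<lambda>t. \<not> t ! i)"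
    using V.heavisides_cases[OF h] by blast
  have "W.indicator_of R (\<lambda>t. \<kappa> t ! i) \<in> VG_filtration W W.hyperplanes R 1"
    using rel[OF i(1)] unfolding three_term_def by (blast intro: W.indicator_degree_1[OF R])
  then show ?thesis
    using i(2) W.indicator_not_degree_1[OF R] by (auto simp: pull)
qed

text \<open>
  The whole filtered algebra depends only on the set of topes: a bijection between two sets of
  topes is an isomorphism if each sign of the image is a three-term combination of the old signs,
  in both directions.
\<close>

lemma VG_isomorphic_of_sign_change:
  assumes V: "form_arrangement V fs" and W: "form_arrangement W gs" and R: "cring R"
    and \<kappa>: "\<kappa> \<in> form_arrangement.topes W gs \<rightarrow> form_arrangement.topes V fs"
      "\<mu> \<in> form_arrangement.topes V fs \<rightarrow> form_arrangement.topes W gs"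
    and inv: "\<And>t. t \<in> form_arrangement.topes V fs \<Longrightarrow> \<kappa> (\<mu> t) = t"
      "\<And>t. t \<in> form_arrangement.topes W gs \<Longrightarrow> \<mu> (\<kappa> t) = t"
    and rel: "\<And>i. i < length fs \<Longrightarrow> three_term (form_arrangement.topes W gs) (length gs) (\<lambda>t. \<kappa> t ! i)"
      "\<And>i. i < length gs \<Longrightarrow> three_term (form_arrangement.topes V fs) (length fs) (\<lambda>t. \<mu> t ! i)"
  shows "VG_isomorphic R V (form_arrangement.hyperplanes V fs) W (form_arrangement.hyperplanes W gs)"
proof -
  interpret V: form_arrangement V fs by fact
  interpret W: form_arrangement W gs by fact
  show ?thesis
  proof (rule VG_isomorphicI[OF R])
    show "(\<lambda>D. V.cell (\<kappa> (W.tope_of D))) \<in> chambers W W.hyperplanes \<rightarrow> chambers V V.hyperplanes"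
      "(\<lambda>C. W.cell (\<mu> (V.tope_of C))) \<in> chambers V V.hyperplanes \<rightarrow> chambers W W.hyperplanes"
      using \<kappa> by (auto simp: V.chambers_eq W.chambers_eq V.tope_of_cell W.tope_of_cell)
  next
    fix C assume "C \<in> chambers V V.hyperplanes"
    then show "V.cell (\<kappa> (W.tope_of (W.cell (\<mu> (V.tope_of C))))) = C"
      using \<kappa> inv by (auto simp: V.chambers_eq V.tope_of_cell W.tope_of_cell Pi_def)
  next
    fix D assume "D \<in> chambers W W.hyperplanes"
    then show "W.cell (\<mu> (V.tope_of (V.cell (\<kappa> (W.tope_of D))))) = D"
      using \<kappa> inv by (auto simp: W.chambers_eq V.tope_of_cell W.tope_of_cell Pi_def)
  next
    fix h assume "h \<in> heavisides V V.hyperplanes R"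
    then show "(\<lambda>D\<in>chambers W W.hyperplanes. h (V.cell (\<kappa> (W.tope_of D))))
        \<in> VG_filtration W W.hyperplanes R 1"
      by (intro heaviside_pullback_degree_1[OF V W R \<kappa>(1) rel(1)])
  next
    fix h assume "h \<in> heavisides W W.hyperplanes R"
    then show "(\<lambda>C\<in>chambers V V.hyperplanes. h (W.cell (\<mu> (V.tope_of C))))
        \<in> VG_filtration V V.hyperplanes R 1"
      by (intro heaviside_pullback_degree_1[OF W V R \<kappa>(2) rel(2)])
  qed
qed

section \<open>Graph isomorphisms preserve degrees\<close>

lemma degree_of_isomorphic:
  assumes bij: "bij_betw f (verts G) (verts H)"
    and adj: "\<And>u v. u \<in> verts G \<Longrightarrow> v \<in> verts G \<Longrightarrow> {u, v} \<in> edges G \<longleftrightarrow> {f u, f v} \<in> edges H"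
    and edges: "\<And>e. e \<in> edges G \<Longrightarrow> \<exists>u\<in>verts G. \<exists>v\<in>verts G. e = {u, v}"
      "\<And>e. e \<in> edges H \<Longrightarrow> \<exists>u\<in>verts H. \<exists>v\<in>verts H. e = {u, v}"
    and v: "v \<in> verts G"
  shows "vertex_degree H (f v) = vertex_degree G v"
proof -
  have inj: "inj_on f (verts G)" and img: "f ` verts G = verts H"
    using bij by (auto simp: bij_betw_def)
  have sub: "{e \<in> edges G. v \<in> e} \<subseteq> Pow (verts G)" using edges(1) by blast
  have image: "(`) f ` {e \<in> edges G. v \<in> e} = {e \<in> edges H. f v \<in> e}"
  proof (intro equalityI subsetI)
    fix e' assume "e' \<in> (`) f ` {e \<in> edges G. v \<in> e}"
    then obtain e where e: "e \<in> edges G" "v \<in> e" "e' = f ` e" by auto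
    from edges(1)[OF e(1)] obtain u w where uw: "u \<in> verts G" "w \<in> verts G" "e = {u, w}"
      by (elim bexE)
    have "e' \<in> edges H" using adj[OF uw(1,2)] e uw(3) by simp
    with e show "e' \<in> {e \<in> edges H. f v \<in> e}" by blast
  next
    fix e' assume e': "e' \<in> {e \<in> edges H. f v \<in> e}"
    then have "e' \<in> edges H" by simp
    from edges(2)[OF this] obtain u' w' where uw': "u' \<in> verts H" "w' \<in> verts H" "e' = {u', w'}"
      by (elim bexE)
    have "u' \<in> f ` verts G" using uw'(1) by (simp only: img)
    then obtain u where u: "u \<in> verts G" "f u = u'" by blast
    have "w' \<in> f ` verts G" using uw'(2) by (simp only: img)
    then obtain w where w: "w \<in> verts G" "f w = w'" by blast
    have uw: "u \<in> verts G" "w \<in> verts G" "e' = {f u, f w}" using u w uw'(3) by auto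
    have "{u, w} \<in> edges G" using adj[OF uw(1,2)] uw(3) e' by simp
    moreover have "v \<in> {u, w}" using e' uw v inj by (auto dest: inj_onD)
    ultimately show "e' \<in> (`) f ` {e \<in> edges G. v \<in> e}"
      using uw by (intro image_eqI[of _ _ "{u, w}"]) auto
  qed
  have "inj_on ((`) f) {e \<in> edges G. v \<in> e}"
    using inj_on_subset[OF inj_on_image_Pow[OF inj] sub] .
  from card_image[OF this] show ?thesis unfolding vertex_degree_def image .
qed

lemma isomorphic_graph_has_degree:
  assumes iso: "graph_isomorphic G H"
    and edges: "\<And>e. e \<in> edges G \<Longrightarrow> \<exists>u\<in>verts G. \<exists>v\<in>verts G. e = {u, v}"
      "\<And>e. e \<in> edges H \<Longrightarrow> \<exists>u\<in>verts H. \<exists>v\<in>verts H. e = {u, v}"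
    and v: "v \<in> verts G"
  shows "\<exists>w\<in>verts H. vertex_degree H w = vertex_degree G v"
proof -
  obtain f where f: "bij_betw f (verts G) (verts H) \<and>
      (\<forall>u\<in>verts G. \<forall>v\<in>verts G. {u, v} \<in> edges G \<longleftrightarrow> {f u, f v} \<in> edges H)"
    using iso unfolding graph_isomorphic_def by (rule exE)
  have "vertex_degree H (f v) = vertex_degree G v"
    by (rule degree_of_isomorphic[OF conjunct1[OF f] conjunct2[OF f, rule_format] edges v])
  moreover have "f v \<in> verts H" using f v by (auto simp: bij_betw_def)
  ultimately show ?thesis by blast
qed

lemma tope_graph_edges:
  assumes "e \<in> edges (tope_graph V A)"
  shows "\<exists>u\<in>verts (tope_graph V A). \<exists>v\<in>verts (tope_graph V A). e = {u, v}"
proof -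
  have "\<exists>C D. e = {C, D} \<and> C \<in> chambers V A \<and> D \<in> chambers V A \<and>
      card {H \<in> A. separates V H C D} = 1"
    using assms by (simp only: tope_graph_def graph.simps mem_Collect_eq)
  then show ?thesis
    unfolding tope_graph_def graph.simps by (elim exE conjE) (intro bexI)
qed

section \<open>Pulling back an arrangement of coordinate space\<close>

text \<open>
  A linear surjection onto coordinate space pulls an arrangement back without changing its topes.
  It transports every statement about topes to any other ambient space.
\<close>

lemma
  assumes "form_arrangement UNIV gs" and V: "subspace V" and c: "linear c" "continuous_on V c"
    and surj: "c ` V = UNIV"
  shows form_arrangement_pullback: "form_arrangement V (map (\<lambda>g. g \<circ> c) gs)"
    and topes_pullback:
      "form_arrangement.topes V (map (\<lambda>g. g \<circ> c) gs) = form_arrangement.topes UNIV gs"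
proof -
  interpret U: form_arrangement UNIV gs by fact
  have lift: "\<exists>v. v \<in> V \<and> c v = w" for w
  proof -
    have "w \<in> c ` V" unfolding surj by (rule UNIV_I)
    then show ?thesis by (elim imageE) blast
  qed
  have hyperplane: "linear_hyperplane V (g \<circ> c) = V \<inter> c -` linear_hyperplane UNIV g" for g
    by (auto simp: linear_hyperplane_def)
  have inj: "inj (\<lambda>H. V \<inter> c -` H)"
  proof (rule injI)
    fix H K assume eq: "V \<inter> c -` H = V \<inter> c -` K"
    have "w \<in> H \<longleftrightarrow> w \<in> K" for w
    proof -
      obtain v where "v \<in> V" "c v = w" using lift by metis
      then show ?thesis using eqset_imp_iff[OF eq, of v] by simp
    qed
    then show "H = K" by blast
  qed
  show V: "form_arrangement V (map (\<lambda>g. g \<circ> c) gs)"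
  \<comment> \<open>The default rule would also unfold the locale predicate linear.\<close>
  proof (rule form_arrangement.intro)
    show "subspace V" by fact
    show "distinct (map (linear_hyperplane V) (map (\<lambda>g. g \<circ> c) gs))"
    proof -
      have "map (linear_hyperplane V) (map (\<lambda>g. g \<circ> c) gs) =
          map (\<lambda>H. V \<inter> c -` H) (map (linear_hyperplane UNIV) gs)"
        by (simp add: hyperplane)
      moreover have "distinct (map (\<lambda>H. V \<inter> c -` H) (map (linear_hyperplane UNIV) gs))"
        unfolding distinct_map[of "\<lambda>H. V \<inter> c -` H"]
        using U.hyperplanes_distinct inj_on_subset[OF inj subset_UNIV] by blast
      ultimately show ?thesis by (simp only:)
    qed
    fix f assume "f \<in> set (map (\<lambda>g. g \<circ> c) gs)"
    then obtain g where g: "g \<in> set gs" "f = g \<circ> c" by auto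
    show "linear f" unfolding g(2) by (rule linear_compose[OF c(1) U.form_linear[OF g(1)]])
    show "continuous_on V f"
      unfolding g(2) by (rule continuous_on_compose[OF c(2) continuous_on_subset[OF U.form_continuous[OF g(1)]]]) simp
    obtain w where "g w \<noteq> 0" using U.form_nonzero[OF g(1)] by auto
    moreover obtain v where "v \<in> V" "c v = w" using lift by metis
    ultimately show "\<exists>v\<in>V. f v \<noteq> 0" unfolding g(2) by auto
  qed
  interpret V: form_arrangement V "map (\<lambda>g. g \<circ> c) gs" by fact
  have compl: "v \<in> complement V V.hyperplanes \<longleftrightarrow> v \<in> V \<and> c v \<in> complement UNIV U.hyperplanes" for v
    by (simp add: V.in_complement_iff U.in_complement_iff)
  have sign: "sign_vector (map (\<lambda>g. g \<circ> c) gs) v = sign_vector gs (c v)" for v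
    by (simp add: sign_vector_def)
  show "V.topes = U.topes"
  proof (intro equalityI subsetI)
    fix t assume "t \<in> V.topes"
    then show "t \<in> U.topes" unfolding V.topes_def U.topes_def sign using compl by blast
  next
    fix t assume "t \<in> U.topes"
    then obtain w where w: "w \<in> complement UNIV U.hyperplanes" "t = sign_vector gs w"
      unfolding U.topes_def by blast
    obtain v where v: "v \<in> V" "c v = w" using lift by metis
    then have "v \<in> complement V V.hyperplanes" using compl w(1) by blast
    moreover have "t = sign_vector (map (\<lambda>g. g \<circ> c) gs) v" using sign v(2) w(2) by simp
    ultimately show "t \<in> V.topes" unfolding V.topes_def by (rule image_eqI[rotated])
  qed
qed

section \<open>The two arrangements and the Cremona transformation\<close>

definition plane_form :: "real \<times> real \<times> real \<Rightarrow> real ^ 3 \<Rightarrow> real" where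
  "plane_form = (\<lambda>(a, b, c) v. a * v$1 + b * v$2 + c * v$3)"

lemma plane_form_apply: "plane_form (a, b, c) v = a * v$1 + b * v$2 + c * v$3"
  by (simp add: plane_form_def)

text \<open>
  The vectors \<open>(b, -a, 0)\<close>, \<open>(c, 0, -a)\<close> and \<open>(0, c, -b)\<close> lie in the first plane; being in the
  second plane as well, they show that the cross product of the two normals vanishes.
\<close>

lemma plane_form_proportional:
  assumes "linear_hyperplane UNIV (plane_form (a, b, c)) = linear_hyperplane UNIV (plane_form (a', b', c'))"
  shows "a * b' = a' * b \<and> a * c' = a' * c \<and> b * c' = b' * c"
proof (intro conjI)
  have ker: "a * x + b * y + c * z = 0 \<longleftrightarrow> a' * x + b' * y + c' * z = 0" for x y z
    using assms[THEN eqset_imp_iff, of "vector [x, y, z]"]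
    by (simp add: linear_hyperplane_def plane_form_apply)
  show "a * b' = a' * b" using ker[of b "- a" 0] by (simp add: mult.commute)
  show "a * c' = a' * c" using ker[of c 0 "- a"] by (simp add: mult.commute)
  show "b * c' = b' * c" using ker[of 0 c "- b"] by (simp add: mult.commute)
qed

lemma linear_plane_form: "linear (plane_form c)"
  by (cases c) (auto intro!: linearI simp: plane_form_apply algebra_simps)

lemma form_arrangement_plane_forms:
  assumes "(0, 0, 0) \<notin> set cs"
    and "distinct (map (linear_hyperplane UNIV) (map plane_form cs))"
  shows "form_arrangement UNIV (map plane_form cs)"
proof (rule form_arrangement.intro)
  fix f assume "f \<in> set (map plane_form cs)"
  then obtain a b c where abc: "(a, b, c) \<in> set cs" "f = plane_form (a, b, c)" by auto
  show "linear f" unfolding abc by (rule linear_plane_form)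
  show "continuous_on UNIV f"
    unfolding abc by (intro linear_continuous_on linear_conv_bounded_linear[THEN iffD1] linear_plane_form)
  have "(a, b, c) \<noteq> (0, 0, 0)" using assms(1) abc(1) by metis
  then have "a^2 + b^2 + c^2 \<noteq> 0" by (simp add: add_nonneg_eq_0_iff)
  then have "f (vector [a, b, c]) \<noteq> 0" unfolding abc(2) by (simp add: plane_form_apply power2_eq_square)
  then show "\<exists>v\<in>UNIV. f v \<noteq> 0" by blast
qed (use assms in auto)

definition A_forms :: "(real ^ 3 \<Rightarrow> real) list" where
  "A_forms = map plane_form
     [(1,0,0), (0,1,0), (0,0,1), (1,1,0), (1,2,0), (1,0,1), (0,1,-2), (0,2,-1)]"

definition kappa_forms :: "(real ^ 3 \<Rightarrow> real) list" where
  "kappa_forms = map plane_form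
     [(1,0,0), (0,1,0), (0,0,1), (1,1,0), (2,1,0), (1,0,1), (0,-2,1), (0,-1,2)]"

lemma length_forms: "length A_forms = 8" "length kappa_forms = 8"
  by (simp_all add: A_forms_def kappa_forms_def)

lemma A_form_arrangement: "form_arrangement UNIV A_forms"
  unfolding A_forms_def
  by (rule form_arrangement_plane_forms) (auto dest!: plane_form_proportional)

lemma kappa_form_arrangement: "form_arrangement UNIV kappa_forms"
  unfolding kappa_forms_def
  by (rule form_arrangement_plane_forms) (auto dest!: plane_form_proportional)

interpretation A: form_arrangement UNIV A_forms
  by (rule A_form_arrangement)

interpretation K: form_arrangement UNIV kappa_forms
  by (rule kappa_form_arrangement)

lemma arrangement_A_eq: "arrangement_A = A.hyperplanes"
  unfolding A.hyperplanes_def arrangement_A_def by (simp add: A_forms_def plane_form_def)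

lemma arrangement_A_kappa_eq: "arrangement_A_kappa = K.hyperplanes"
  unfolding K.hyperplanes_def arrangement_A_kappa_def
  by (simp add: kappa_forms_def plane_form_def add.commute)

lemma sign_vector_A:
  "sign_vector A_forms v =
    [v$1 > 0, v$2 > 0, v$3 > 0, v$1 + v$2 > 0, v$1 + 2 * v$2 > 0, v$1 + v$3 > 0,
     v$2 - 2 * v$3 > 0, 2 * v$2 - v$3 > 0]"
  by (simp add: sign_vector_def A_forms_def plane_form_apply)

lemma in_complement_A:
  "v \<in> complement UNIV A.hyperplanes \<longleftrightarrow>
    v$1 \<noteq> 0 \<and> v$2 \<noteq> 0 \<and> v$3 \<noteq> 0 \<and> v$1 + v$2 \<noteq> 0 \<and> v$1 + 2 * v$2 \<noteq> 0 \<and> v$1 + v$3 \<noteq> 0 \<and>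
    v$2 - 2 * v$3 \<noteq> 0 \<and> 2 * v$2 - v$3 \<noteq> 0"
  unfolding A.in_complement_iff by (simp add: A_forms_def plane_form_apply)

lemma sign_vector_kappa:
  "sign_vector kappa_forms v =
    [v$1 > 0, v$2 > 0, v$3 > 0, v$1 + v$2 > 0, 2 * v$1 + v$2 > 0, v$1 + v$3 > 0,
     v$3 - 2 * v$2 > 0, 2 * v$3 - v$2 > 0]"
  by (simp add: sign_vector_def kappa_forms_def plane_form_apply)

lemma in_complement_kappa:
  "v \<in> complement UNIV K.hyperplanes \<longleftrightarrow>
    v$1 \<noteq> 0 \<and> v$2 \<noteq> 0 \<and> v$3 \<noteq> 0 \<and> v$1 + v$2 \<noteq> 0 \<and> 2 * v$1 + v$2 \<noteq> 0 \<and> v$1 + v$3 \<noteq> 0 \<and>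
    v$3 - 2 * v$2 \<noteq> 0 \<and> 2 * v$3 - v$2 \<noteq> 0"
  unfolding K.in_complement_iff by (simp add: kappa_forms_def plane_form_apply)

lemma A_tope_cases:
  assumes "t \<in> A.topes"
  obtains v where "v \<in> complement UNIV A.hyperplanes" "t = sign_vector A_forms v"
  using assms unfolding A.topes_def by (rule imageE)

lemma kappa_tope_cases:
  assumes "t \<in> K.topes"
  obtains v where "v \<in> complement UNIV K.hyperplanes" "t = sign_vector kappa_forms v"
  using assms unfolding K.topes_def by (rule imageE)

definition cremona :: "real ^ 3 \<Rightarrow> real ^ 3" where
  "cremona v = (\<chi> i. inverse (v$i))"

text \<open>
  Effect of the Cremona transformation on signs.  Substituting inverses into a form in \<open>x\<close> and \<open>y\<close>
  gives the corresponding form of the other arrangement divided by \<open>xy\<close>, so its sign is multiplied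
  by those of \<open>x\<close> and \<open>y\<close>.  In Booleans the sign of \<open>xy\<close> is an equality, and so is a product of signs.
\<close>

definition cremona_signs :: "bool list \<Rightarrow> bool list" where
  "cremona_signs t = [t!0, t!1, t!2, t!3 = (t!0 = t!1), t!4 = (t!0 = t!1), t!5 = (t!0 = t!2),
     t!6 = (t!1 = t!2), t!7 = (t!1 = t!2)]"

lemma combination_of_inverses:
  fixes x y a b :: real
  assumes "x \<noteq> 0" "y \<noteq> 0" "a * y + b * x \<noteq> 0"
  shows "a * inverse x + b * inverse y \<noteq> 0"
    "a * inverse x + b * inverse y > 0 \<longleftrightarrow> (a * y + b * x > 0 \<longleftrightarrow> (x > 0 \<longleftrightarrow> y > 0))"
proof -
  have eq: "a * inverse x + b * inverse y = (a * y + b * x) / (x * y)"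
    using assms by (simp add: field_simps)
  show "a * inverse x + b * inverse y \<noteq> 0" unfolding eq using assms by simp
  show "a * inverse x + b * inverse y > 0 \<longleftrightarrow> (a * y + b * x > 0 \<longleftrightarrow> (x > 0 \<longleftrightarrow> y > 0))"
    unfolding eq zero_less_divide_iff zero_less_mult_iff mult_less_0_iff using assms by linarith
qed

lemma cremona_A:
  assumes "v \<in> complement UNIV A.hyperplanes"
  shows "cremona v \<in> complement UNIV K.hyperplanes"
    "sign_vector kappa_forms (cremona v) =
      cremona_signs (sign_vector A_forms v)"
  using assms combination_of_inverses[of "v$1" "v$2" 1 1] combination_of_inverses[of "v$1" "v$2" 2 1]
    combination_of_inverses[of "v$1" "v$3" 1 1] combination_of_inverses[of "v$2" "v$3" "-2" 1]
    combination_of_inverses[of "v$2" "v$3" "-1" 2]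
  unfolding in_complement_A in_complement_kappa sign_vector_A sign_vector_kappa cremona_signs_def cremona_def
  by (simp_all add: algebra_simps)

lemma cremona_kappa:
  assumes "v \<in> complement UNIV K.hyperplanes"
  shows "cremona v \<in> complement UNIV A.hyperplanes"
    "sign_vector A_forms (cremona v) =
      cremona_signs (sign_vector kappa_forms v)"
  using assms combination_of_inverses[of "v$1" "v$2" 1 1] combination_of_inverses[of "v$1" "v$2" 1 2]
    combination_of_inverses[of "v$1" "v$3" 1 1] combination_of_inverses[of "v$2" "v$3" 1 "-2"]
    combination_of_inverses[of "v$2" "v$3" 2 "-1"]
  unfolding in_complement_A in_complement_kappa sign_vector_A sign_vector_kappa cremona_signs_def cremona_def
  by (simp_all add: algebra_simps)

lemma cremona_signs_involutive:
  assumes "length t = 8" shows "cremona_signs (cremona_signs t) = t"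
proof (rule nth_equalityI)
  show "length (cremona_signs (cremona_signs t)) = length t"
    using assms by (simp add: cremona_signs_def)
  fix i assume "i < length (cremona_signs (cremona_signs t))"
  then have "i \<in> {0, 1, 2, 3, 4, 5, 6, 7}" by (auto simp: cremona_signs_def)
  then show "cremona_signs (cremona_signs t) ! i = t ! i"
    by (auto simp: cremona_signs_def)
qed

lemma cremona_topes:
  shows "cremona_signs \<in> A.topes \<rightarrow> K.topes" and "cremona_signs \<in> K.topes \<rightarrow> A.topes"
proof -
  have "cremona_signs t \<in> K.topes" if "t \<in> A.topes" for t
  proof -
    from that obtain v where v: "v \<in> complement UNIV A.hyperplanes" "t = sign_vector A_forms v"
      by (rule A_tope_cases)
    show ?thesis
      unfolding v(2) cremona_A(2)[OF v(1), symmetric] K.topes_def by (intro imageI cremona_A(1) v(1))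
  qed
  then show "cremona_signs \<in> A.topes \<rightarrow> K.topes" by blast
  have "cremona_signs t \<in> A.topes" if "t \<in> K.topes" for t
  proof -
    from that obtain v where v: "v \<in> complement UNIV K.hyperplanes" "t = sign_vector kappa_forms v"
      by (rule kappa_tope_cases)
    show ?thesis
      unfolding v(2) cremona_kappa(2)[OF v(1), symmetric] A.topes_def
      by (intro imageI cremona_kappa(1) v(1))
  qed
  then show "cremona_signs \<in> K.topes \<rightarrow> A.topes" by blast
qed

lemma three_termI:
  assumes "j < n" "k < n" "l < n"
    and "\<And>t. t \<in> T \<Longrightarrow> of_bool (P t) + of_bool (t ! l) = (of_bool (t ! j) + of_bool (t ! k) :: nat)"
  shows "three_term T n P"
  unfolding three_term_def using assms by blast

text \<open>
  The form \<open>f = x + y\<close> cannot be negative where \<open>x\<close> and \<open>y\<close> are positive, nor positive where both are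
  negative.  On the remaining sign patterns the indicator of \<open>xyf > 0\<close> equals \<open>h\<^sub>x + h\<^sub>y - h\<^sub>f\<close>.  The same
  holds for \<open>x + 2y\<close> and \<open>x + z\<close>.  For a form \<open>f\<close> combining \<open>y\<close> and \<open>-z\<close> positively, replacing \<open>z\<close>
  by \<open>-z\<close> and passing to the complementary indicator turns the identity into \<open>h\<^sub>z + h\<^sub>f - h\<^sub>y\<close>.
\<close>

lemma cremona_three_term_A:
  assumes "i < 8" shows "three_term A.topes 8 (\<lambda>t. cremona_signs t ! i)"
proof -
  consider "i = 0 \<or> i = 1 \<or> i = 2" | "i = 3" | "i = 4" | "i = 5" | "i = 6" | "i = 7"
    using assms by linarith
  then show ?thesis
  proof cases
    case 1
    then show ?thesis by (intro three_termI[of i _ i i]) (auto simp: cremona_signs_def)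
  next
    case 2
    show ?thesis unfolding 2
      by (rule three_termI[of 0 _ 1 3]) (auto elim!: A_tope_cases simp: in_complement_A sign_vector_A cremona_signs_def)
  next
    case 3
    show ?thesis unfolding 3
      by (rule three_termI[of 0 _ 1 4]) (auto elim!: A_tope_cases simp: in_complement_A sign_vector_A cremona_signs_def)
  next
    case 4
    show ?thesis unfolding 4
      by (rule three_termI[of 0 _ 2 5]) (auto elim!: A_tope_cases simp: in_complement_A sign_vector_A cremona_signs_def)
  next
    case 5
    show ?thesis unfolding 5
      by (rule three_termI[of 2 _ 6 1]) (auto elim!: A_tope_cases simp: in_complement_A sign_vector_A cremona_signs_def)
  next
    case 6
    show ?thesis unfolding 6
      by (rule three_termI[of 2 _ 7 1]) (auto elim!: A_tope_cases simp: in_complement_A sign_vector_A cremona_signs_def)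
  qed
qed

text \<open>
  The same identities; the last two forms are now positive combinations of \<open>Z\<close> and \<open>-Y\<close>, which
  exchanges the roles of the second and third coordinate.
\<close>

lemma cremona_three_term_kappa:
  assumes "i < 8" shows "three_term K.topes 8 (\<lambda>t. cremona_signs t ! i)"
proof -
  consider "i = 0 \<or> i = 1 \<or> i = 2" | "i = 3" | "i = 4" | "i = 5" | "i = 6" | "i = 7"
    using assms by linarith
  then show ?thesis
  proof cases
    case 1
    then show ?thesis by (intro three_termI[of i _ i i]) (auto simp: cremona_signs_def)
  next
    case 2
    show ?thesis unfolding 2
      by (rule three_termI[of 0 _ 1 3]) (auto elim!: kappa_tope_cases simp: in_complement_kappa sign_vector_kappa cremona_signs_def)
  next
    case 3
    show ?thesis unfolding 3
      by (rule three_termI[of 0 _ 1 4]) (auto elim!: kappa_tope_cases simp: in_complement_kappa sign_vector_kappa cremona_signs_def)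
  next
    case 4
    show ?thesis unfolding 4
      by (rule three_termI[of 0 _ 2 5]) (auto elim!: kappa_tope_cases simp: in_complement_kappa sign_vector_kappa cremona_signs_def)
  next
    case 5
    show ?thesis unfolding 5
      by (rule three_termI[of 1 _ 6 2]) (auto elim!: kappa_tope_cases simp: in_complement_kappa sign_vector_kappa cremona_signs_def)
  next
    case 6
    show ?thesis unfolding 6
      by (rule three_termI[of 1 _ 7 2]) (auto elim!: kappa_tope_cases simp: in_complement_kappa sign_vector_kappa cremona_signs_def)
  qed
qed

lemma VG_isomorphic_of_topes:
  assumes V: "form_arrangement V fs" "form_arrangement.topes V fs = A.topes" "length fs = 8"
    and W: "form_arrangement W gs" "form_arrangement.topes W gs = K.topes" "length gs = 8"
    and R: "cring R"
  shows "VG_isomorphic R V (form_arrangement.hyperplanes V fs) W (form_arrangement.hyperplanes W gs)"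
proof (rule VG_isomorphic_of_sign_change[OF V(1) W(1) R, where \<kappa> = cremona_signs and \<mu> = cremona_signs])
  show "cremona_signs (cremona_signs t) = t" if "t \<in> form_arrangement.topes V fs" for t
    using A.length_tope[of t] that by (intro cremona_signs_involutive) (simp add: V length_forms)
  show "cremona_signs (cremona_signs t) = t" if "t \<in> form_arrangement.topes W gs" for t
    using K.length_tope[of t] that by (intro cremona_signs_involutive) (simp add: W length_forms)
  show "cremona_signs \<in> form_arrangement.topes W gs \<rightarrow> form_arrangement.topes V fs"
    "cremona_signs \<in> form_arrangement.topes V fs \<rightarrow> form_arrangement.topes W gs"
    unfolding V(2) W(2) by (fact cremona_topes)+
  show "three_term (form_arrangement.topes W gs) (length gs) (\<lambda>t. cremona_signs t ! i)"
    if "i < length fs" for i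
    using that unfolding V(3) W(2,3) by (rule cremona_three_term_kappa)
  show "three_term (form_arrangement.topes V fs) (length fs) (\<lambda>t. cremona_signs t ! i)"
    if "i < length gs" for i
    using that unfolding W(3) V(2,3) by (rule cremona_three_term_A)
qed

section \<open>The degrees of the two tope graphs\<close>

text \<open>
  Sign vector of the point \<open>(-1, 2, 2)\<close>; its chamber is a cone over a pentagon.
\<close>

definition pentagon :: "bool list" where
  "pentagon = [False, True, True, True, True, True, False, True]"

lemma A_topeI:
  fixes x y z :: real
  assumes "x \<noteq> 0" "y \<noteq> 0" "z \<noteq> 0" "x + y \<noteq> 0" "x + 2 * y \<noteq> 0" "x + z \<noteq> 0" "y - 2 * z \<noteq> 0" "2 * y - z \<noteq> 0"
    and "t = [x > 0, y > 0, z > 0, x + y > 0, x + 2 * y > 0, x + z > 0, y - 2 * z > 0, 2 * y - z > 0]"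
  shows "t \<in> A.topes"
  unfolding A.topes_def
  by (rule image_eqI[of _ _ "vector [x, y, z]"]) (use assms in \<open>simp_all add: sign_vector_A in_complement_A\<close>)

lemma pentagon_tope: "pentagon \<in> A.topes"
  by (rule A_topeI[of "-1" 2 2]) (simp_all add: pentagon_def)

text \<open>
  Three of the eight flips contradict a linear relation: \<open>x + y\<close>, \<open>x + z\<close> and
  \<open>x + 2y = (x + y) + y\<close> are sums of forms whose signs would agree with each other but not with that of the sum.  The other five are
  realised by explicit points.
\<close>

lemma pentagon_flips: "A.flips pentagon = {0, 3, 5, 6, 7}"
proof -
  have infeasible: "\<not> (\<not> t ! 0 \<and> \<not> t ! 1 \<and> t ! 3)" "\<not> (\<not> t ! 0 \<and> \<not> t ! 2 \<and> t ! 5)"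
      "\<not> (t ! 1 \<and> t ! 3 \<and> \<not> t ! 4)" if t: "t \<in> A.topes" for t
  proof -
    from t obtain v where "v \<in> complement UNIV A.hyperplanes" "t = sign_vector A_forms v"
      by (rule A_tope_cases)
    then show "\<not> (\<not> t ! 0 \<and> \<not> t ! 1 \<and> t ! 3)" "\<not> (\<not> t ! 0 \<and> \<not> t ! 2 \<and> t ! 5)" "\<not> (t ! 1 \<and> t ! 3 \<and> \<not> t ! 4)"
      by (auto simp: sign_vector_A in_complement_A)
  qed
  let ?flip = "\<lambda>i. pentagon[i := \<not> pentagon ! i]"
  have "?flip 1 \<notin> A.topes" "?flip 2 \<notin> A.topes" "?flip 4 \<notin> A.topes"
    using infeasible(1)[of "?flip 1"] infeasible(2)[of "?flip 2"] infeasible(3)[of "?flip 4"]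
    by (auto simp: pentagon_def eval_nat_numeral)
  moreover have "?flip 0 \<in> A.topes"
    by (rule A_topeI[of 1 1 1]) (simp_all add: pentagon_def)
  moreover have "?flip 3 \<in> A.topes"
    by (rule A_topeI[of "-4" 3 5]) (simp_all add: pentagon_def eval_nat_numeral)
  moreover have "?flip 5 \<in> A.topes"
    by (rule A_topeI[of "-4" 5 3]) (simp_all add: pentagon_def eval_nat_numeral)
  moreover have "?flip 6 \<in> A.topes"
    by (rule A_topeI[of "-1" 5 2]) (simp_all add: pentagon_def eval_nat_numeral)
  moreover have "?flip 7 \<in> A.topes"
    by (rule A_topeI[of "-1" 2 5]) (simp_all add: pentagon_def eval_nat_numeral)
  moreover have "A.flips pentagon = {i \<in> {0, 1, 2, 3, 4, 5, 6, 7}. ?flip i \<in> A.topes}"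
    unfolding A.flips_def length_forms by (rule Collect_cong) auto
  ultimately show ?thesis by (simp only: Collect_conv_if insert_iff) (auto)
qed

text \<open>
  In each implication the third form is a positive combination of the first two (up to the indicated
  sign): \<open>2X+Y = 2(X+Y) - Y\<close>, \<open>2(X+Z) = (2X+Y) + (2Z-Y)\<close>, \<open>2Z-Y = 2(Z-2Y) + 3Y\<close>,
  \<open>2X+Y = 2X + Y\<close> and \<open>2Z = (2Z-Y) + Y\<close>.  Among all relations between the eight forms, these five
  already bound the degrees.
\<close>

definition kappa_circuits :: "bool list \<Rightarrow> bool" where
  "kappa_circuits t \<longleftrightarrow>
     (t!1 \<noteq> t!3 \<longrightarrow> t!4 = t!3) \<and>
     (t!4 = t!7 \<longrightarrow> t!5 = t!4) \<and>
     (t!1 = t!6 \<longrightarrow> t!7 = t!1) \<and>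
     (t!0 = t!1 \<longrightarrow> t!4 = t!0) \<and>
     (t!1 = t!7 \<longrightarrow> t!2 = t!1)"

lemma kappa_tope_circuits:
  assumes "t \<in> K.topes" shows "kappa_circuits t"
proof -
  from assms obtain v where "v \<in> complement UNIV K.hyperplanes" "t = sign_vector kappa_forms v"
    by (rule kappa_tope_cases)
  then show ?thesis
    by (simp add: sign_vector_kappa in_complement_kappa kappa_circuits_def) linarith
qed

lemma kappa_circuits_list:
  "kappa_circuits [a, b, c, d, e, f, g, h] \<longleftrightarrow>
    (b \<noteq> d \<longrightarrow> e = d) \<and> (e = h \<longrightarrow> f = e) \<and> (b = g \<longrightarrow> h = b) \<and> (a = b \<longrightarrow> e = a) \<and> (b = h \<longrightarrow> c = b)"
  by (simp add: kappa_circuits_def)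

text \<open>
  If \<open>w\<close> is a positive combination of \<open>u\<close> and \<open>v\<close>, exactly one of the three signs cannot be flipped
  alone: that of \<open>w\<close> when \<open>u\<close> and \<open>v\<close> agree, and otherwise that of the one among \<open>u\<close> and \<open>v\<close> which
  agrees with \<open>w\<close>.  That the five relations block at least four different flips among the eight is left
  to a case distinction.
\<close>

lemma kappa_circuits_flips:
  assumes "kappa_circuits t" "length t = 8"
  shows "card {i. i < 8 \<and> kappa_circuits (t[i := \<not> t ! i])} \<le> 4"
proof -
  obtain a b c d e f g h where t: "t = [a, b, c, d, e, f, g, h]"
    using assms(2) by (auto simp: numeral_eq_Suc length_Suc_conv)
  have upt: "[0..<8] = [0, 1, 2, 3, 4, 5, 6, 7]" by (simp add: upt_rec)
  \<comment> \<open>The filter is turned into a sum of truth values, to which case distinction on the signs applies.\<close>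
  have "{i. i < 8 \<and> kappa_circuits (t[i := \<not> t ! i])} =
      set (filter (\<lambda>i. kappa_circuits (t[i := \<not> t ! i])) [0..<8])" by simp
  also have "card \<dots> \<le> length (filter (\<lambda>i. kappa_circuits (t[i := \<not> t ! i])) [0..<8])"
    by (rule card_length)
  also have "\<dots> = of_bool (kappa_circuits [\<not> a, b, c, d, e, f, g, h]) + of_bool (kappa_circuits [a, \<not> b, c, d, e, f, g, h])
    + of_bool (kappa_circuits [a, b, \<not> c, d, e, f, g, h]) + of_bool (kappa_circuits [a, b, c, \<not> d, e, f, g, h])
    + of_bool (kappa_circuits [a, b, c, d, \<not> e, f, g, h]) + of_bool (kappa_circuits [a, b, c, d, e, \<not> f, g, h])
    + of_bool (kappa_circuits [a, b, c, d, e, f, \<not> g, h]) + of_bool (kappa_circuits [a, b, c, d, e, f, g, \<not> h])"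
    by (simp add: upt t eval_nat_numeral)
  also have "\<dots> \<le> 4"
    using assms(1) unfolding t kappa_circuits_list
    by (cases a; cases b; cases d; cases e; cases h; simp)
  finally show ?thesis .
qed

lemma kappa_flips:
  assumes "t \<in> K.topes" shows "card (K.flips t) \<le> 4"
proof -
  have "length t = 8" using K.length_tope[OF assms] by (simp add: length_forms)
  then have "card {i. i < 8 \<and> kappa_circuits (t[i := \<not> t ! i])} \<le> 4"
    by (rule kappa_circuits_flips[OF kappa_tope_circuits[OF assms]])
  moreover have "K.flips t \<subseteq> {i. i < 8 \<and> kappa_circuits (t[i := \<not> t ! i])}"
    using kappa_tope_circuits by (auto simp: K.flips_def length_forms)
  then have "card (K.flips t) \<le> card {i. i < 8 \<and> kappa_circuits (t[i := \<not> t ! i])}"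
    by (rule card_mono[rotated]) simp
  ultimately show ?thesis by linarith
qed

lemma tope_graph_A_degree_5:
  assumes V: "form_arrangement V fs" "form_arrangement.topes V fs = A.topes" "length fs = 8"
  defines "G \<equiv> tope_graph V (form_arrangement.hyperplanes V fs)"
  shows "\<exists>C \<in> verts G. antipode C \<in> verts G \<and> vertex_degree G C = 5 \<and> vertex_degree G (antipode C) = 5"
proof -
  interpret V: form_arrangement V fs by fact
  have tope: "pentagon \<in> V.topes" unfolding V(2) by (rule pentagon_tope)
  have "V.flips pentagon = A.flips pentagon"
    unfolding V.flips_def A.flips_def V(2,3) length_forms ..
  then have deg: "card (V.flips pentagon) = 5" by (simp add: pentagon_flips)
  have verts: "V.cell t \<in> verts G" if "t \<in> V.topes" for t
    using V.cell_in_chambers[OF that] by (simp add: G_def tope_graph_def)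
  have "vertex_degree G (V.cell pentagon) = 5"
    unfolding G_def V.degree_cell[OF tope] by (rule deg)
  moreover have "vertex_degree G (antipode (V.cell pentagon)) = 5"
    unfolding G_def V.antipode_cell V.degree_cell[OF V.topes_antipode[OF tope]] V.flips_antipode[OF tope]
    by (rule deg)
  moreover have "antipode (V.cell pentagon) \<in> verts G"
    unfolding V.antipode_cell by (rule verts[OF V.topes_antipode[OF tope]])
  ultimately show ?thesis using verts[OF tope] by blast
qed

lemma tope_graph_kappa_degree_le_4:
  assumes W: "form_arrangement W gs" "form_arrangement.topes W gs = K.topes" "length gs = 8"
    and D: "D \<in> verts (tope_graph W (form_arrangement.hyperplanes W gs))"
  shows "vertex_degree (tope_graph W (form_arrangement.hyperplanes W gs)) D \<le> 4"
proof -
  interpret W: form_arrangement W gs by fact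
  obtain t where t: "t \<in> W.topes" "D = W.cell t"
    using D by (auto simp: tope_graph_def W.chambers_eq)
  have "W.flips t = K.flips t"
    unfolding W.flips_def K.flips_def W(2,3) length_forms ..
  then show ?thesis
    using kappa_flips[of t] t(1) unfolding t(2) W.degree_cell[OF t(1)] W(2) by simp
qed

lemma tope_graphs_A_kappa_not_isomorphic:
  assumes V: "form_arrangement V fs" "form_arrangement.topes V fs = A.topes" "length fs = 8"
    and W: "form_arrangement W gs" "form_arrangement.topes W gs = K.topes" "length gs = 8"
  shows "\<not> graph_isomorphic (tope_graph V (form_arrangement.hyperplanes V fs))
    (tope_graph W (form_arrangement.hyperplanes W gs))"
proof
  assume iso: "graph_isomorphic (tope_graph V (form_arrangement.hyperplanes V fs))
    (tope_graph W (form_arrangement.hyperplanes W gs))"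
  obtain C where C: "C \<in> verts (tope_graph V (form_arrangement.hyperplanes V fs))"
    "vertex_degree (tope_graph V (form_arrangement.hyperplanes V fs)) C = 5"
    using tope_graph_A_degree_5[OF V] by (elim bexE conjE)
  obtain D where "D \<in> verts (tope_graph W (form_arrangement.hyperplanes W gs))"
    "vertex_degree (tope_graph W (form_arrangement.hyperplanes W gs)) D = 5"
    using isomorphic_graph_has_degree[OF iso tope_graph_edges tope_graph_edges C(1)] C(2) by metis
  with tope_graph_kappa_degree_le_4[OF W] show False by fastforce
qed

section \<open>A copy inside the finitely supported sequences\<close>

lemma lookup_scaleR: "Poly_Mapping.lookup (r *\<^sub>R p) n = r *\<^sub>R Poly_Mapping.lookup p n"
proof -
  have "finite {i. r *\<^sub>R Poly_Mapping.lookup p i \<noteq> 0}"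
    by (rule finite_subset[OF _ finite_lookup[of p]]) auto
  then show ?thesis by (simp add: scaleR_poly_mapping_def lookup_Abs_poly_mapping)
qed

text \<open>
  The norm of a finitely supported sequence is the sum of the norms of its entries, so it bounds each entry.
\<close>

lemma bounded_linear_lookup: "bounded_linear (\<lambda>p :: 'a \<Rightarrow>\<^sub>0 real. Poly_Mapping.lookup p n)"
proof (rule bounded_linear_intro[where K = 1])
  fix p :: "'a \<Rightarrow>\<^sub>0 real"
  have "norm (Poly_Mapping.lookup p n) \<le> (\<Sum>i\<in>Poly_Mapping.keys p. norm (Poly_Mapping.lookup p i))"
  proof (cases "n \<in> Poly_Mapping.keys p")
    case True
    then show ?thesis
      by (intro member_le_sum[of n _ "\<lambda>i. norm (Poly_Mapping.lookup p i)"]) auto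
  next
    case False
    then show ?thesis by (simp add: in_keys_iff sum_nonneg)
  qed
  then show "norm (Poly_Mapping.lookup p n) \<le> norm p * 1"
    by (simp add: norm_poly_mapping_def dist_poly_mapping_def)
qed (simp_all add: lookup_add lookup_scaleR)

definition coords :: "(nat \<Rightarrow>\<^sub>0 real) \<Rightarrow> real ^ 3" where
  "coords p = (\<chi> i. Poly_Mapping.lookup p (if i = 1 then 0 else if i = 2 then 1 else 2))"

definition coordinate_basis :: "(nat \<Rightarrow>\<^sub>0 real) set" where
  "coordinate_basis = {Poly_Mapping.single 0 1, Poly_Mapping.single 1 1, Poly_Mapping.single 2 1}"

lemma finite_coordinate_basis: "finite coordinate_basis"
  by (simp add: coordinate_basis_def)

lemma linear_coords: "linear coords"
  by (rule linearI) (simp_all add: coords_def vec_eq_iff lookup_add lookup_scaleR)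

lemma continuous_coords: "continuous_on S coords"
  unfolding coords_def
  by (intro continuous_on_vec_lambda linear_continuous_on bounded_linear_lookup)

lemma coords_surj: "coords ` span coordinate_basis = UNIV"
proof -
  have "w \<in> coords ` span coordinate_basis" for w
  proof (rule image_eqI)
    let ?p = "w$1 *\<^sub>R Poly_Mapping.single 0 1 + w$2 *\<^sub>R Poly_Mapping.single 1 1 + w$3 *\<^sub>R Poly_Mapping.single 2 1"
    show "?p \<in> span coordinate_basis"
      by (intro span_add span_scale span_base) (simp_all add: coordinate_basis_def)
    show "w = coords ?p"
      by (simp add: vec_eq_iff forall_3 coords_def lookup_add lookup_scaleR lookup_single del: single_one)
  qed
  then show ?thesis by blast
qed

lemmas coordinate_copy =
  form_arrangement_pullback[OF _ subspace_span linear_coords continuous_coords coords_surj]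
  topes_pullback[OF _ subspace_span linear_coords continuous_coords coords_surj]

lemma int_ring_char: "ring_char int_ring = 0"
proof -
  have "[n] \<cdot>\<^bsub>int_ring\<^esub> \<one>\<^bsub>int_ring\<^esub> = int n" for n :: nat
    by (induction n) (simp_all add: add_pow_def)
  then show ?thesis by (simp add: ring_char_def)
qed

theorem mainTheorem2:
  shows "(\<forall>R :: 'r ring. cring R \<longrightarrow> VG_isomorphic R UNIV arrangement_A UNIV arrangement_A_kappa) \<and>
    (\<exists>C \<in> verts (tope_graph UNIV arrangement_A).
       antipode C \<in> verts (tope_graph UNIV arrangement_A) \<and>
       vertex_degree (tope_graph UNIV arrangement_A) C = 5 \<and>
       vertex_degree (tope_graph UNIV arrangement_A) (antipode C) = 5) \<and>
    \<not> (\<exists>D \<in> verts (tope_graph UNIV arrangement_A_kappa).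
         vertex_degree (tope_graph UNIV arrangement_A_kappa) D = 5) \<and>
    \<not> graph_isomorphic (tope_graph UNIV arrangement_A) (tope_graph UNIV arrangement_A_kappa) \<and>
    \<not> (\<forall>(V\<^sub>1 :: (nat \<Rightarrow>\<^sub>0 real) set) B\<^sub>1 (V\<^sub>2 :: (nat \<Rightarrow>\<^sub>0 real) set) B\<^sub>2 (R :: int ring).
         central_arrangement V\<^sub>1 B\<^sub>1 \<and> central_arrangement V\<^sub>2 B\<^sub>2 \<and>
         domain R \<and> ring_char R \<noteq> 2 \<and> VG_isomorphic R V\<^sub>1 B\<^sub>1 V\<^sub>2 B\<^sub>2 \<longrightarrow>
         graph_isomorphic (tope_graph V\<^sub>1 B\<^sub>1) (tope_graph V\<^sub>2 B\<^sub>2))"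
proof -
  note A = A_form_arrangement refl length_forms(1)
  note K = kappa_form_arrangement refl length_forms(2)
  let ?V = "span coordinate_basis"
  let ?fs = "map (\<lambda>g. g \<circ> coords) A_forms" and ?gs = "map (\<lambda>g. g \<circ> coords) kappa_forms"
  have V: "form_arrangement ?V ?fs" "form_arrangement.topes ?V ?fs = A.topes" "length ?fs = 8"
    by (simp_all add: coordinate_copy A_form_arrangement length_forms)
  have W: "form_arrangement ?V ?gs" "form_arrangement.topes ?V ?gs = K.topes" "length ?gs = 8"
    by (simp_all add: coordinate_copy kappa_form_arrangement length_forms)
  let ?B\<^sub>1 = "form_arrangement.hyperplanes ?V ?fs" and ?B\<^sub>2 = "form_arrangement.hyperplanes ?V ?gs"
  have central: "central_arrangement ?V ?B\<^sub>1" "central_arrangement ?V ?B\<^sub>2"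
    by (rule form_arrangement.central[OF V(1) finite_coordinate_basis refl]
        form_arrangement.central[OF W(1) finite_coordinate_basis refl])+
  have domain: "domain int_ring" by (rule int.domain_axioms)
  have char: "ring_char int_ring \<noteq> 2" by (simp add: int_ring_char)
  have iso: "VG_isomorphic int_ring ?V ?B\<^sub>1 ?V ?B\<^sub>2"
    by (rule VG_isomorphic_of_topes[OF V W int_is_cring])
  have not_iso: "\<not> graph_isomorphic (tope_graph ?V ?B\<^sub>1) (tope_graph ?V ?B\<^sub>2)"
    by (rule tope_graphs_A_kappa_not_isomorphic[OF V W])
  show ?thesis
    unfolding arrangement_A_eq arrangement_A_kappa_eq
  proof (intro conjI)
    show "\<forall>R :: 'r ring. cring R \<longrightarrow> VG_isomorphic R UNIV A.hyperplanes UNIV K.hyperplanes"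
      using VG_isomorphic_of_topes[OF A K] by blast
    show "\<exists>C \<in> verts (tope_graph UNIV A.hyperplanes).
       antipode C \<in> verts (tope_graph UNIV A.hyperplanes) \<and>
       vertex_degree (tope_graph UNIV A.hyperplanes) C = 5 \<and>
       vertex_degree (tope_graph UNIV A.hyperplanes) (antipode C) = 5"
      by (rule tope_graph_A_degree_5[OF A])
    show "\<not> (\<exists>D \<in> verts (tope_graph UNIV K.hyperplanes).
         vertex_degree (tope_graph UNIV K.hyperplanes) D = 5)"
      using tope_graph_kappa_degree_le_4[OF K] by fastforce
    show "\<not> graph_isomorphic (tope_graph UNIV A.hyperplanes) (tope_graph UNIV K.hyperplanes)"
      by (rule tope_graphs_A_kappa_not_isomorphic[OF A K])
    show "\<not> (\<forall>(V\<^sub>1 :: (nat \<Rightarrow>\<^sub>0 real) set) B\<^sub>1 (V\<^sub>2 :: (nat \<Rightarrow>\<^sub>0 real) set) B\<^sub>2 (R :: int ring).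
         central_arrangement V\<^sub>1 B\<^sub>1 \<and> central_arrangement V\<^sub>2 B\<^sub>2 \<and>
         domain R \<and> ring_char R \<noteq> 2 \<and> VG_isomorphic R V\<^sub>1 B\<^sub>1 V\<^sub>2 B\<^sub>2 \<longrightarrow>
         graph_isomorphic (tope_graph V\<^sub>1 B\<^sub>1) (tope_graph V\<^sub>2 B\<^sub>2))"
    proof
      assume all: "\<forall>(V\<^sub>1 :: (nat \<Rightarrow>\<^sub>0 real) set) B\<^sub>1 (V\<^sub>2 :: (nat \<Rightarrow>\<^sub>0 real) set) B\<^sub>2 (R :: int ring).
         central_arrangement V\<^sub>1 B\<^sub>1 \<and> central_arrangement V\<^sub>2 B\<^sub>2 \<and>
         domain R \<and> ring_char R \<noteq> 2 \<and> VG_isomorphic R V\<^sub>1 B\<^sub>1 V\<^sub>2 B\<^sub>2 \<longrightarrow>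
         graph_isomorphic (tope_graph V\<^sub>1 B\<^sub>1) (tope_graph V\<^sub>2 B\<^sub>2)"
      have "graph_isomorphic (tope_graph ?V ?B\<^sub>1) (tope_graph ?V ?B\<^sub>2)"
        by (rule all[rule_format, OF conjI[OF central(1) conjI[OF central(2) conjI[OF domain conjI[OF char iso]]]]])
      with not_iso show False by contradiction
    qed
  qed
qed

end
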